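(* Let $H$ be a Hopf $*$-algebra over $\mathbb{C}$ with conjugation operation $\dagger$, and let $F\in H\otimes H$ be an arbitrary twist. Let $H_F$ be the quasi-Hopf algebra obtained from $H$ (regarded as a quasi-Hopf algebra with $\Phi=1\otimes1\otimes1$, $\alpha=\beta=1$) by twisting with $F$, with coproduct $\Delta_F$ and co-associator $\Phi_F$. Put $\Omega=(FF^\dagger)^{-1}$. Then $\Omega$ is a self-adjoint twist ($\Omega^\dagger=\Omega$) and $H_F$, with the same conjugation $\dagger$, is a quasi-Hopf $*$-algebra with $*$-canonical element $\Omega$; in particular $$\Delta_F(a)^\dagger=\Omega\,\Delta_F(a^\dagger)\,\Omega^{-1}\quad\forall a\in H,$$ $$(\Phi_F^\dagger)^{-1}=(\Omega\otimes1)\,(\Delta_F\otimes1)(\Omega)\,\Phi_F\,(1\otimes\Delta_F)(\Omega^{-1})\,(1\otimes\Omega^{-1}).$$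
   Context: Base field $\mathbb{C}$; $1$ also denotes the identity map; $m$ is multiplication. A conjugation operation on an algebra $H$ is an antilinear map $\dagger:H\to H$ with $(a^\dagger)^\dagger=a$, $(ab)^\dagger=b^\dagger a^\dagger$; it is extended to tensor powers by $(a\otimes b)^\dagger=a^\dagger\otimes b^\dagger$, etc. A Hopf $*$-algebra is a Hopf algebra with a conjugation operation satisfying $\varepsilon(a^\dagger)=\overline{\varepsilon(a)}$ and $\Delta(a^\dagger)=\Delta(a)^\dagger$ for all $a$. A quasi-Hopf algebra (QHA) is a unital associative algebra $H$ with algebra homomorphisms $\varepsilon:H\to\mathbb{C}$, $\Delta:H\to H\otimes H$, an invertible $\Phi\in H^{\otimes3}$ (co-associator; write $\Phi=\sum_\nu X_\nu\otimes Y_\nu\otimes Z_\nu$, $\Phi^{-1}=\sum_\nu\bar X_\nu\otimes\bar Y_\nu\otimes\bar Z_\nu$), a bijective algebra anti-homomorphism $S:H\to H$ and $\alpha,\beta\in H$ such that: $(\varepsilon\otimes1)\Delta=1=(1\otimes\varepsilon)\Delta$; $(1\otimes\Delta)\Delta(a)=\Phi^{-1}(\Delta\otimes1)\Delta(a)\Phi$; $(\Delta\otimes1\otimes1)\Phi\cdot(1\otimes1\otimes\Delta)\Phi=(\Phi\otimes1)\cdot(1\otimes\Delta\otimes1)\Phi\cdot(1\otimes\Phi)$; $(1\otimes\varepsilon\otimes1)\Phi=1$; $\sum_\nu S(X_\nu)\alpha Y_\nu\beta S(Z_\nu)=1=\sum_\nu\bar X_\nu\beta S(\bar Y_\nu)\alpha\bar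 Z_\nu$; $\sum S(a_{(1)})\alpha a_{(2)}=\varepsilon(a)\alpha$ and $\sum a_{(1)}\beta S(a_{(2)})=\varepsilon(a)\beta$ for all $a$. A twist is an invertible $F\in H\otimes H$ with $(\varepsilon\otimes1)F=(1\otimes\varepsilon)F=1$. Twisting a QHA $H$ by $F$ gives the QHA $H_F$ with the same algebra, $\varepsilon$, $S$ and $\Delta_F(a)=F\Delta(a)F^{-1}$, $\Phi_F=(F\otimes1)(\Delta\otimes1)(F)\,\Phi\,(1\otimes\Delta)(F^{-1})(1\otimes F^{-1})$, $\alpha_F=m(1\otimes\alpha)(S\otimes1)F^{-1}$, $\beta_F=m(1\otimes\beta)(1\otimes S)F$. A quasi-Hopf $*$-algebra ($*$-QHA) is a QHA $H$ with a conjugation operation $\dagger$ and a twist $\Omega$ (the $*$-canonical element) with $\varepsilon(a^\dagger)=\overline{\varepsilon(a)}$, $\Delta(a)^\dagger=\Omega\Delta(a^\dagger)\Omega^{-1}$ for all $a$, and $(\Phi^\dagger)^{-1}=\Phi_\Omega=(\Omega\otimes1)(\Delta\otimes1)(\Omega)\,\Phi\,(1\otimes\Delta)(\Omega^{-1})(1\otimes\Omega^{-1})$. *)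

theory Defs
  imports Complex_Main "HOL-Library.Multiset"
begin

section \<open>Complex vector spaces and unital associative algebras\<close>

class complex_vector = ab_group_add +
  fixes scaleC :: "complex \<Rightarrow> 'a \<Rightarrow> 'a"  (infixr "*\<^sub>C" 75)
  assumes scaleC_add_right: "c *\<^sub>C (x + y) = c *\<^sub>C x + c *\<^sub>C y"
    and scaleC_add_left: "(c + d) *\<^sub>C x = c *\<^sub>C x + d *\<^sub>C x"
    and scaleC_scaleC: "c *\<^sub>C (d *\<^sub>C x) = (c * d) *\<^sub>C x"
    and scaleC_one: "1 *\<^sub>C x = x"

interpretation complex_vector: vector_space "scaleC :: complex \<Rightarrow> 'a \<Rightarrow> 'a::complex_vector"
  by unfold_locales
    (rule scaleC_add_right scaleC_add_left scaleC_scaleC scaleC_one)+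

abbreviation clinear :: "('a::complex_vector \<Rightarrow> 'b::complex_vector) \<Rightarrow> bool"
  where "clinear \<equiv> Vector_Spaces.linear scaleC scaleC"

text \<open>\<^class>\<open>ring_1\<close> would also require \<open>0 \<noteq> 1\<close>; the zero algebra is not excluded here.\<close>

class complex_algebra_1 = complex_vector + ring + monoid_mult +
  assumes mult_scaleC_left: "(c *\<^sub>C x) * y = c *\<^sub>C (x * y)"
    and mult_scaleC_right: "x * (c *\<^sub>C y) = c *\<^sub>C (x * y)"

instantiation complex :: complex_algebra_1
begin
definition scaleC_complex :: "complex \<Rightarrow> complex \<Rightarrow> complex"
  where "scaleC_complex c x = c * x"
instance
  by standard (simp_all add: scaleC_complex_def algebra_simps)
end

definition algebra_hom :: "('a::complex_algebra_1 \<Rightarrow> 'b::complex_algebra_1) \<Rightarrow> bool"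
  where "algebra_hom f \<longleftrightarrow> clinear f \<and> (\<forall>x y. f (x * y) = f x * f y) \<and> f 1 = 1"

definition algebra_antihom :: "('a::complex_algebra_1 \<Rightarrow> 'b::complex_algebra_1) \<Rightarrow> bool"
  where "algebra_antihom f \<longleftrightarrow> clinear f \<and> (\<forall>x y. f (x * y) = f y * f x) \<and> f 1 = 1"

definition antilinear :: "('a::complex_vector \<Rightarrow> 'b::complex_vector) \<Rightarrow> bool"
  where "antilinear f \<longleftrightarrow>
    (\<forall>x y. f (x + y) = f x + f y) \<and> (\<forall>c x. f (c *\<^sub>C x) = cnj c *\<^sub>C f x)"

definition invertible :: "'a::monoid_mult \<Rightarrow> bool"
  where "invertible x \<longleftrightarrow> (\<exists>y. x * y = 1 \<and> y * x = 1)"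

text \<open>Only meaningful for invertible arguments.\<close>

definition minv :: "'a::monoid_mult \<Rightarrow> 'a"
  where "minv x = (THE y. x * y = 1 \<and> y * x = 1)"

lemma minv_unique:
  fixes x :: "'a::monoid_mult"
  assumes "x * y = 1" "y * x = 1"
  shows "minv x = y"
  unfolding minv_def
proof (rule the_equality)
  fix z assume "x * z = 1 \<and> z * x = 1"
  then show "z = y"
    using assms by (metis mult.assoc mult_1_left mult_1_right)
qed (use assms in simp)

lemma minv_inverse:
  fixes x :: "'a::monoid_mult"
  assumes "invertible x"
  shows "x * minv x = 1" "minv x * x = 1"
  using assms minv_unique[of x] by (auto simp: invertible_def)

section \<open>The tensor product over the complex numbers\<close>

text \<open>
  A finite multiset of pairs stands for the formal sum of the corresponding simple tensors.
  The tensor product is the free commutative monoid of formal sums modulo the congruence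
  generated by biadditivity and balancedness; it is a group since \<open>(-a, b)\<close> represents the
  negative of \<open>(a, b)\<close>.  Its universal property is recorded below
  (\<open>tlift_add\<close>, \<open>tlift_tensor\<close>, \<open>tensor_induct\<close>).
\<close>

inductive tensor_eq ::
  "('a::complex_vector \<times> 'b::complex_vector) multiset \<Rightarrow> ('a \<times> 'b) multiset \<Rightarrow> bool"
where
  refl: "tensor_eq M M"
| sym: "tensor_eq M N \<Longrightarrow> tensor_eq N M"
| trans: "tensor_eq M N \<Longrightarrow> tensor_eq N K \<Longrightarrow> tensor_eq M K"
| cong: "tensor_eq M N \<Longrightarrow> tensor_eq (M + K) (N + K)"
| zero: "tensor_eq {#(0, b)#} {#}"
| add_left: "tensor_eq {#(a + a', b)#} {#(a, b), (a', b)#}"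
| add_right: "tensor_eq {#(a, b + b')#} {#(a, b), (a, b')#}"
| balanced: "tensor_eq {#(c *\<^sub>C a, b)#} {#(a, c *\<^sub>C b)#}"

quotient_type (overloaded) ('a, 'b) tensor =
  "('a::complex_vector \<times> 'b::complex_vector) multiset" / tensor_eq
  by (intro equivpI reflpI sympI transpI) (blast intro: tensor_eq.intros)+

type_notation tensor (infixr "\<otimes>" 70)

lift_definition tensor :: "'a::complex_vector \<Rightarrow> 'b::complex_vector \<Rightarrow> 'a \<otimes> 'b"
    (infixr "\<otimes>" 72)
  is "\<lambda>a b. {#(a, b)#}" .

instantiation tensor :: (complex_vector, complex_vector) comm_monoid_add
begin
lift_definition zero_tensor :: "'a \<otimes> 'b" is "{#}" .
lift_definition plus_tensor :: "'a \<otimes> 'b \<Rightarrow> 'a \<otimes> 'b \<Rightarrow> 'a \<otimes> 'b" is "(+)"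
  by (metis add.commute tensor_eq.cong tensor_eq.trans)
instance
  by standard (transfer; simp add: ac_simps tensor_eq.refl)+
end

lemma tensor_zero_left [simp]: "0 \<otimes> b = 0"
  by transfer (rule tensor_eq.zero)

lemma tensor_add_left: "(a + a') \<otimes> b = a \<otimes> b + a' \<otimes> b"
  by transfer (use tensor_eq.add_left in \<open>simp add: add_mset_commute\<close>)

lemma tensor_add_right: "a \<otimes> (b + b') = a \<otimes> b + a \<otimes> b'"
  by transfer (use tensor_eq.add_right in \<open>simp add: add_mset_commute\<close>)

lemma tensor_balanced: "(c *\<^sub>C a) \<otimes> b = a \<otimes> (c *\<^sub>C b)"
  by transfer (rule tensor_eq.balanced)

lemma tensor_induct [case_names zero tensor add, induct type: tensor]:
  fixes t :: "'a::complex_vector \<otimes> 'b::complex_vector"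
  assumes "P 0" "\<And>a b. P (a \<otimes> b)" "\<And>s t. P s \<Longrightarrow> P t \<Longrightarrow> P (s + t)"
  shows "P t"
proof -
  have "P (abs_tensor M)" for M :: "('a \<times> 'b) multiset"
  proof (induction M)
    case empty
    then show ?case using assms(1) by (simp add: zero_tensor_def)
  next
    case (add p M)
    have "abs_tensor (add_mset p M) = fst p \<otimes> snd p + abs_tensor M"
      by (simp add: tensor.abs_eq plus_tensor.abs_eq)
    then show ?case using assms add by simp
  qed
  then show ?thesis by (metis Quotient3_abs_rep Quotient3_tensor)
qed

definition balanced ::
  "('a::complex_vector \<Rightarrow> 'b::complex_vector \<Rightarrow> 'c::comm_monoid_add) \<Rightarrow> bool"
where "balanced g \<longleftrightarrow>
  (\<forall>b. g 0 b = 0) \<and>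
  (\<forall>a a' b. g (a + a') b = g a b + g a' b) \<and>
  (\<forall>a b b'. g a (b + b') = g a b + g a b') \<and>
  (\<forall>c a b. g (c *\<^sub>C a) b = g a (c *\<^sub>C b))"

text \<open>
  The map on the tensor product induced by \<open>g\<close>, sending \<open>\<Sum>\<^sub>i a\<^sub>i \<otimes> b\<^sub>i\<close> to \<open>\<Sum>\<^sub>i g a\<^sub>i b\<^sub>i\<close>.
  It is only meaningful for balanced \<open>g\<close>, where the value does not depend on the
  chosen representative.
\<close>

definition tlift ::
  "('a::complex_vector \<Rightarrow> 'b::complex_vector \<Rightarrow> 'c::comm_monoid_add) \<Rightarrow> 'a \<otimes> 'b \<Rightarrow> 'c"
where "tlift g t = (\<Sum>(a, b)\<in>#rep_tensor t. g a b)"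

lemma tlift_abs:
  assumes "balanced g"
  shows "tlift g (abs_tensor M) = (\<Sum>(a, b)\<in>#M. g a b)"
proof -
  have *: "(\<Sum>(a, b)\<in>#M. g a b) = (\<Sum>(a, b)\<in>#N. g a b)" if "tensor_eq M N" for M N
    using that by induction (use assms in \<open>simp_all add: balanced_def\<close>)
  have "tensor_eq (rep_tensor (abs_tensor M)) M"
    by (metis Quotient3_rep_abs Quotient3_tensor tensor_eq.refl)
  then show ?thesis unfolding tlift_def by (rule *)
qed

lemma tlift_tensor [simp]: "balanced g \<Longrightarrow> tlift g (a \<otimes> b) = g a b"
  by (simp add: tensor.abs_eq tlift_abs)

lemma tlift_zero [simp]: "balanced g \<Longrightarrow> tlift g 0 = 0"
  by (simp add: zero_tensor_def tlift_abs)

lemma tlift_add [simp]: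
  assumes "balanced g"
  shows "tlift g (s + t) = tlift g s + tlift g t"
proof -
  obtain M N where "s = abs_tensor M" "t = abs_tensor N"
    by (metis Quotient3_abs_rep Quotient3_tensor)
  then show ?thesis by (simp add: assms plus_tensor.abs_eq tlift_abs)
qed

lemma balanced_scale: "balanced (\<lambda>a b. (c *\<^sub>C a) \<otimes> b)"
  unfolding balanced_def
proof (intro conjI allI)
  fix d :: complex and a :: 'a and b :: 'b
  have "c *\<^sub>C d *\<^sub>C a = d *\<^sub>C c *\<^sub>C a"
    by (rule complex_vector.scale_left_commute)
  then show "(c *\<^sub>C d *\<^sub>C a) \<otimes> b = (c *\<^sub>C a) \<otimes> (d *\<^sub>C b)"
    by (simp only: tensor_balanced)
qed (simp_all only: scaleC_add_right tensor_add_left tensor_add_right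
    complex_vector.scale_zero_right tensor_zero_left)

lemma balanced_minus:
  "balanced (\<lambda>(a::'a::complex_vector) (b::'b::complex_vector). (- a) \<otimes> b)"
proof -
  have "(- 1) *\<^sub>C a = - a" for a :: 'a
    by (simp only: complex_vector.scale_minus_left scaleC_one)
  then show ?thesis using balanced_scale[of "- 1"] by simp
qed

lemma balanced_tensor: "balanced (\<otimes>)"
  by (simp add: balanced_def tensor_add_left tensor_add_right tensor_balanced)

instantiation tensor :: (complex_vector, complex_vector) complex_vector
begin
definition uminus_tensor :: "'a \<otimes> 'b \<Rightarrow> 'a \<otimes> 'b"
  where "uminus_tensor = tlift (\<lambda>a b. (- a) \<otimes> b)"
definition minus_tensor :: "'a \<otimes> 'b \<Rightarrow> 'a \<otimes> 'b \<Rightarrow> 'a \<otimes> 'b"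
  where "minus_tensor s t = s + (- t)"
definition scaleC_tensor :: "complex \<Rightarrow> 'a \<otimes> 'b \<Rightarrow> 'a \<otimes> 'b"
  where "scaleC_tensor c = tlift (\<lambda>a b. (c *\<^sub>C a) \<otimes> b)"
instance
proof
  fix s t :: "'a \<otimes> 'b" and c d :: complex
  show "- t + t = 0"
    unfolding uminus_tensor_def
  proof (induction t)
    case (tensor a b)
    then show ?case by (simp add: balanced_minus flip: tensor_add_left)
  next
    case (add s t)
    let ?m = "tlift (\<lambda>a b. (- a) \<otimes> b)"
    have "?m (s + t) + (s + t) = (?m s + s) + (?m t + t)"
      by (simp add: balanced_minus ac_simps)
    then show ?case using add by simp
  qed (simp add: balanced_minus)
  show "s - t = s + - t" by (simp add: minus_tensor_def)
  show "c *\<^sub>C (s + t) = c *\<^sub>C s + c *\<^sub>C t"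
    by (simp add: scaleC_tensor_def balanced_scale)
  show "(c + d) *\<^sub>C t = c *\<^sub>C t + d *\<^sub>C t"
    unfolding scaleC_tensor_def
  proof (induction t)
    case (tensor a b)
    have "((c + d) *\<^sub>C a) \<otimes> b = (c *\<^sub>C a) \<otimes> b + (d *\<^sub>C a) \<otimes> b"
      by (simp only: scaleC_add_left tensor_add_left)
    then show ?case by (simp add: balanced_scale)
  qed (simp_all add: balanced_scale ac_simps)
  show "c *\<^sub>C (d *\<^sub>C t) = (c * d) *\<^sub>C t"
    unfolding scaleC_tensor_def
    by (induction t) (simp_all add: balanced_scale)
  show "1 *\<^sub>C t = t"
    unfolding scaleC_tensor_def by (induction t) (simp_all add: balanced_tensor)
qed
end

lemma scaleC_tensor_left: "(c *\<^sub>C a) \<otimes> b = c *\<^sub>C (a \<otimes> b)"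
  by (simp add: scaleC_tensor_def balanced_scale)

lemma scaleC_tensor_right: "a \<otimes> (c *\<^sub>C b) = c *\<^sub>C (a \<otimes> b)"
  by (metis scaleC_tensor_left tensor_balanced)

lemma tensor_zero_right [simp]: "a \<otimes> 0 = 0"
  by (metis complex_vector.scale_zero_left scaleC_tensor_right)

lemma balanced_mult1:
  fixes a :: "'a::complex_algebra_1" and b :: "'b::complex_algebra_1"
  shows "balanced (\<lambda>c d. (a * c) \<otimes> (b * d))"
  by (simp add: balanced_def tensor_add_left tensor_add_right distrib_left
      mult_scaleC_right tensor_balanced)

lemma balanced_mult2:
  fixes t :: "'a::complex_algebra_1 \<otimes> 'b::complex_algebra_1"
  shows "balanced (\<lambda>a b. tlift (\<lambda>c d. (a * c) \<otimes> (b * d)) t)"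
  unfolding balanced_def
proof (intro conjI allI)
  fix a a' :: 'a and b b' :: 'b and k :: complex
  show "tlift (\<lambda>c d. (0 * c) \<otimes> (b * d)) t = 0"
    by (induction t) (simp_all del: mult_zero_left add: balanced_mult1, simp)
  show "tlift (\<lambda>c d. ((a + a') * c) \<otimes> (b * d)) t =
      tlift (\<lambda>c d. (a * c) \<otimes> (b * d)) t + tlift (\<lambda>c d. (a' * c) \<otimes> (b * d)) t"
    by (induction t)
      (simp_all add: balanced_mult1 ac_simps,
       simp add: distrib_right tensor_add_left)
  show "tlift (\<lambda>c d. (a * c) \<otimes> ((b + b') * d)) t =
      tlift (\<lambda>c d. (a * c) \<otimes> (b * d)) t + tlift (\<lambda>c d. (a * c) \<otimes> (b' * d)) t"
    by (induction t)
      (simp_all add: balanced_mult1 ac_simps,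
       simp add: distrib_right tensor_add_right)
  show "tlift (\<lambda>c d. ((k *\<^sub>C a) * c) \<otimes> (b * d)) t =
      tlift (\<lambda>c d. (a * c) \<otimes> ((k *\<^sub>C b) * d)) t"
    by (induction t)
      (simp_all add: balanced_mult1, simp add: mult_scaleC_left tensor_balanced)
qed

instantiation tensor :: (complex_algebra_1, complex_algebra_1) complex_algebra_1
begin
definition one_tensor :: "'a \<otimes> 'b"
  where "one_tensor = 1 \<otimes> 1"
definition times_tensor :: "'a \<otimes> 'b \<Rightarrow> 'a \<otimes> 'b \<Rightarrow> 'a \<otimes> 'b"
  where "times_tensor s t = tlift (\<lambda>a b. tlift (\<lambda>c d. (a * c) \<otimes> (b * d)) t) s"
instance
proof
  have zl: "0 * t = 0" and dl: "(s + s') * t = s * t + s' * t" for s s' t :: "'a \<otimes> 'b"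
    by (simp_all add: times_tensor_def balanced_mult2)
  have m: "(a \<otimes> b) * t = tlift (\<lambda>c d. (a * c) \<otimes> (b * d)) t" for a b and t :: "'a \<otimes> 'b"
    by (simp add: times_tensor_def balanced_mult2)
  have mm: "(a \<otimes> b) * (c \<otimes> d) = (a * c) \<otimes> (b * d)" for a c :: 'a and b d :: 'b
    by (simp add: m balanced_mult1)
  have zr: "s * 0 = 0" and dr: "s * (t + t') = s * t + s * t'" for s t t' :: "'a \<otimes> 'b"
    by (induction s; simp add: zl dl m balanced_mult1 ac_simps)+
  fix s t u :: "'a \<otimes> 'b" and c :: complex
  show "(s + t) * u = s * u + t * u" by (rule dl)
  show "s * (t + u) = s * t + s * u" by (rule dr)
  show "s * t * u = s * (t * u)"
  proof (induction s)
    case (tensor a b)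
    show ?case
    proof (induction t)
      case (tensor a' b')
      show ?case
        by (induction u) (simp_all add: zr dr mm mult.assoc)
    qed (simp_all add: zl zr dl dr)
  qed (simp_all add: zl dl)
  show "1 * t = t"
    by (induction t) (simp_all add: zr dr one_tensor_def mm)
  show "t * 1 = t"
    by (induction t) (simp_all add: zl dl one_tensor_def mm)
  show "c *\<^sub>C s * t = c *\<^sub>C (s * t)"
  proof (induction s)
    case (tensor a b)
    show ?case
      by (induction t)
        (simp_all add: zr dr mm mult_scaleC_left scaleC_add_right flip: scaleC_tensor_left)
  qed (simp_all add: zl dl scaleC_add_right)
  show "s * c *\<^sub>C t = c *\<^sub>C (s * t)"
  proof (induction s)
    case (tensor a b)
    show ?case
      by (induction t)
        (simp_all add: zr dr mm mult_scaleC_right scaleC_add_right flip: scaleC_tensor_left)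
  qed (simp_all add: zl dl scaleC_add_right)
qed
end

lemma mult_tensor: "(a \<otimes> b) * (c \<otimes> d) = (a * c) \<otimes> (b * d)"
  unfolding times_tensor_def
  by (subst tlift_tensor[OF balanced_mult2]) (rule tlift_tensor[OF balanced_mult1])

text \<open>
  The tensor product of two maps that are both linear or both antilinear.
\<close>

definition tmap ::
  "('a::complex_vector \<Rightarrow> 'c::complex_vector) \<Rightarrow> ('b::complex_vector \<Rightarrow> 'd::complex_vector) \<Rightarrow>
    'a \<otimes> 'b \<Rightarrow> 'c \<otimes> 'd"
where "tmap f g = tlift (\<lambda>a b. f a \<otimes> g b)"

definition tassoc ::
  "('a::complex_vector \<otimes> 'b::complex_vector) \<otimes> 'c::complex_vector \<Rightarrow> 'a \<otimes> ('b \<otimes> 'c)"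
where "tassoc = tlift (\<lambda>s c. tlift (\<lambda>a b. a \<otimes> (b \<otimes> c)) s)"

definition tmult :: "'a::complex_algebra_1 \<otimes> 'a \<Rightarrow> 'a"
  where "tmult = tlift (*)"

text \<open>The maps \<open>\<epsilon> \<otimes> 1\<close> and \<open>1 \<otimes> \<epsilon>\<close>, with the scalar tensor factor absorbed.\<close>

definition eps_left ::
  "('a::complex_vector \<Rightarrow> complex) \<Rightarrow> 'a \<otimes> 'b::complex_vector \<Rightarrow> 'b"
where "eps_left \<epsilon> = tlift (\<lambda>a b. \<epsilon> a *\<^sub>C b)"

definition eps_right ::
  "('b::complex_vector \<Rightarrow> complex) \<Rightarrow> 'a::complex_vector \<otimes> 'b \<Rightarrow> 'a"
where "eps_right \<epsilon> = tlift (\<lambda>a b. \<epsilon> b *\<^sub>C a)"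

section \<open>Hopf algebras and quasi-Hopf algebras\<close>

text \<open>
  Tensor powers are nested to the right; \<open>\<otimes>\<close> is right associative.  Maps and elements that
  arise with another bracketing, such as \<open>\<Delta> \<otimes> 1\<close> and \<open>F \<otimes> 1\<close>, are rebracketed by \<open>tassoc\<close>.
\<close>

locale hopf_algebra =
  fixes \<Delta> :: "'h::complex_algebra_1 \<Rightarrow> 'h \<otimes> 'h"
    and \<epsilon> :: "'h \<Rightarrow> complex"
    and S :: "'h \<Rightarrow> 'h"
  assumes comul_hom: "algebra_hom \<Delta>"
    and counit_hom: "algebra_hom \<epsilon>"
    and coassociative: "tmap id \<Delta> (\<Delta> a) = tassoc (tmap \<Delta> id (\<Delta> a))"
    and counit_left: "eps_left \<epsilon> (\<Delta> a) = a"
    and counit_right: "eps_right \<epsilon> (\<Delta> a) = a"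
    and antipode_linear: "clinear S"
    and antipode_left: "tmult (tmap S id (\<Delta> a)) = \<epsilon> a *\<^sub>C 1"
    and antipode_right: "tmult (tmap id S (\<Delta> a)) = \<epsilon> a *\<^sub>C 1"

definition conjugation :: "('h::complex_algebra_1 \<Rightarrow> 'h) \<Rightarrow> bool"
  where "conjugation d \<longleftrightarrow>
    antilinear d \<and> (\<forall>a. d (d a) = a) \<and> (\<forall>a b. d (a * b) = d b * d a)"

abbreviation conj2 :: "('h::complex_algebra_1 \<Rightarrow> 'h) \<Rightarrow> 'h \<otimes> 'h \<Rightarrow> 'h \<otimes> 'h"
  where "conj2 d \<equiv> tmap d d"

abbreviation conj3 :: "('h::complex_algebra_1 \<Rightarrow> 'h) \<Rightarrow> 'h \<otimes> 'h \<otimes> 'h \<Rightarrow> 'h \<otimes> 'h \<otimes> 'h"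
  where "conj3 d \<equiv> tmap d (tmap d d)"

locale hopf_star_algebra = hopf_algebra \<Delta> \<epsilon> S
  for \<Delta> :: "'h::complex_algebra_1 \<Rightarrow> 'h \<otimes> 'h" and \<epsilon> S +
  fixes dagger :: "'h \<Rightarrow> 'h"
  assumes conjugation: "conjugation dagger"
    and counit_dagger: "\<epsilon> (dagger a) = cnj (\<epsilon> a)"
    and comul_dagger: "\<Delta> (dagger a) = conj2 dagger (\<Delta> a)"

record (overloaded) 'h quasi_hopf =
  comul :: "'h::complex_algebra_1 \<Rightarrow> 'h \<otimes> 'h"
  counit :: "'h \<Rightarrow> complex"
  coassociator :: "'h \<otimes> 'h \<otimes> 'h"
  antipode :: "'h \<Rightarrow> 'h"
  alpha :: 'h
  beta :: 'h

text \<open>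
  In \<open>pentagon\<close>, \<open>tassoc\<close> after \<open>\<Delta> \<otimes> (1 \<otimes> 1)\<close> rebrackets \<open>(a \<otimes> b) \<otimes> (c \<otimes> d)\<close>, and
  \<open>tmap id tassoc (tassoc _)\<close> rebrackets \<open>(a \<otimes> (b \<otimes> c)) \<otimes> d\<close>.
  In \<open>antipode_coassociator\<close>, the product \<open>\<Sum>\<^sub>\<nu> S(X\<^sub>\<nu>) \<alpha> Y\<^sub>\<nu> \<beta> S(Z\<^sub>\<nu>)\<close> is a nested
  \<^const>\<open>tlift\<close>; likewise in \<open>antipode_coassociator_inv\<close>.
\<close>

locale quasi_hopf_algebra =
  fixes H :: "'h::complex_algebra_1 quasi_hopf"
  assumes comul_hom: "algebra_hom (comul H)"
    and counit_hom: "algebra_hom (counit H)"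
    and coassociator_invertible: "invertible (coassociator H)"
    and antipode_antihom: "algebra_antihom (antipode H)"
    and antipode_bij: "bij (antipode H)"
    and counit_left: "eps_left (counit H) (comul H a) = a"
    and counit_right: "eps_right (counit H) (comul H a) = a"
    and quasi_coassociative:
      "tmap id (comul H) (comul H a) =
        minv (coassociator H) * tassoc (tmap (comul H) id (comul H a)) * coassociator H"
    and pentagon:
      "tassoc (tmap (comul H) id (coassociator H)) *
         tmap id (tmap id (comul H)) (coassociator H) =
       tmap id tassoc (tassoc (coassociator H \<otimes> (1 :: 'h))) *
         tmap id (\<lambda>t. tassoc (tmap (comul H) id t)) (coassociator H) *
         ((1 :: 'h) \<otimes> coassociator H)"
    and coassociator_counit: "tmap id (eps_left (counit H)) (coassociator H) = 1"
    and antipode_coassociator: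
      "tlift (\<lambda>x. tlift (\<lambda>y z. antipode H x * alpha H * y * beta H * antipode H z))
         (coassociator H) = 1"
    and antipode_coassociator_inv:
      "tlift (\<lambda>x. tlift (\<lambda>y z. x * beta H * antipode H y * alpha H * z))
         (minv (coassociator H)) = 1"
    and antipode_left:
      "tlift (\<lambda>x y. antipode H x * alpha H * y) (comul H a) = counit H a *\<^sub>C alpha H"
    and antipode_right:
      "tlift (\<lambda>x y. x * beta H * antipode H y) (comul H a) = counit H a *\<^sub>C beta H"

definition quasi_hopf_of_hopf ::
  "('h::complex_algebra_1 \<Rightarrow> 'h \<otimes> 'h) \<Rightarrow> ('h \<Rightarrow> complex) \<Rightarrow> ('h \<Rightarrow> 'h) \<Rightarrow> 'h quasi_hopf"
where "quasi_hopf_of_hopf \<Delta> \<epsilon> S =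
  \<lparr>comul = \<Delta>, counit = \<epsilon>, coassociator = 1 \<otimes> 1 \<otimes> 1, antipode = S, alpha = 1, beta = 1\<rparr>"

definition is_twist :: "('h::complex_algebra_1 \<Rightarrow> complex) \<Rightarrow> 'h \<otimes> 'h \<Rightarrow> bool"
  where "is_twist \<epsilon> F \<longleftrightarrow> invertible F \<and> eps_left \<epsilon> F = 1 \<and> eps_right \<epsilon> F = 1"

definition twisted_coassociator ::
  "'h::complex_algebra_1 quasi_hopf \<Rightarrow> 'h \<otimes> 'h \<Rightarrow> 'h \<otimes> 'h \<otimes> 'h"
where "twisted_coassociator H F =
  tassoc (F \<otimes> (1 :: 'h)) * tassoc (tmap (comul H) id F) * coassociator H *
  tmap id (comul H) (minv F) * ((1 :: 'h) \<otimes> minv F)"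

definition twist :: "'h::complex_algebra_1 quasi_hopf \<Rightarrow> 'h \<otimes> 'h \<Rightarrow> 'h quasi_hopf"
where "twist H F =
  \<lparr>comul = (\<lambda>a. F * comul H a * minv F),
   counit = counit H,
   coassociator = twisted_coassociator H F,
   antipode = antipode H,
   alpha = tmult ((1 \<otimes> alpha H) * tmap (antipode H) id (minv F)),
   beta = tmult ((1 \<otimes> beta H) * tmap id (antipode H) F)\<rparr>"

locale quasi_hopf_star_algebra = quasi_hopf_algebra H
  for H :: "'h::complex_algebra_1 quasi_hopf" +
  fixes dagger :: "'h \<Rightarrow> 'h"
    and \<Omega> :: "'h \<otimes> 'h"
  assumes conjugation: "conjugation dagger"
    and canonical_twist: "is_twist (counit H) \<Omega>"
    and counit_dagger: "counit H (dagger a) = cnj (counit H a)"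
    and comul_dagger: "conj2 dagger (comul H a) = \<Omega> * comul H (dagger a) * minv \<Omega>"
    and coassociator_dagger:
      "minv (conj3 dagger (coassociator H)) = twisted_coassociator H \<Omega>"

end

theory Submission
  imports Defs
begin

text \<open>
  Write \<open>F\<^sub>1\<^sub>2 = F \<otimes> 1\<close> and \<open>F\<^sub>2\<^sub>3 = 1 \<otimes> F\<close>.  The twisted co-associator is a quotient
  \<open>U V\<^sup>-\<^sup>1\<close> with \<open>U = F\<^sub>1\<^sub>2 (\<Delta> \<otimes> 1)(F)\<close> and \<open>V = F\<^sub>2\<^sub>3 (1 \<otimes> \<Delta>)(F)\<close>: the elements that
  conjugate the two iterated coproducts of \<open>H\<close>, which agree, into the two iterated coproducts
  of \<open>H\<^sub>F\<close>.  Quasi-coassociativity is immediate from this.  In the pentagon, the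
  maps \<open>H \<otimes> H \<rightarrow> H \<otimes> H \<otimes> H \<otimes> H\<close> composed of embeddings and coproducts are algebra homomorphisms;
  coassociativity identifies those that differ only in the order of the coproducts, and \<open>F \<otimes> 1 \<otimes> 1\<close> commutes with
  \<open>1 \<otimes> 1 \<otimes> F\<close>.  After that everything cancels (\<open>twisted_pentagon\<close>).

  The antipode axioms rest on two actions of \<open>H \<otimes> H\<close> on \<open>H\<close>, namely
  \<open>\<alpha> \<mapsto> \<Sum> S(p) \<alpha> q\<close> and \<open>\<beta> \<mapsto> \<Sum> p \<beta> S(q)\<close> for \<open>\<Sum> p \<otimes> q \<in> H \<otimes> H\<close>.  They turn \<open>1\<close> into the twisted elements
  \<open>\<alpha>\<^sub>F\<close> and \<open>\<beta>\<^sub>F\<close>, and back again, so that the outer factors of \<open>\<Phi>\<^sub>F\<close> undo the twisting of \<open>\<alpha>\<close> and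
  \<open>\<beta>\<close>, while the inner factors collapse by the Hopf antipode axioms and the counit conditions
  on \<open>F\<close>.  For this \<open>S\<close> must be an anti-homomorphism, which follows from uniqueness of convolution
  inverses (\<open>antipode_antihom\<close>), and bijective, which holds because \<open>\<dagger> S \<dagger>\<close> inverts it
  (\<open>bij_antipode\<close>).

  For the conjugation, put \<open>G = (F\<^sup>\<dagger>)\<^sup>-\<^sup>1\<close>.  Since \<open>\<dagger>\<close> reverses products and commutes with \<open>\<Delta>\<close>, it carries
  \<open>\<Delta>\<^sub>F(a)\<close> to \<open>\<Delta>\<^sub>G(a\<^sup>\<dagger>)\<close> and \<open>\<Phi>\<^sub>F\<close> to \<open>\<Phi>\<^sub>G\<^sup>-\<^sup>1\<close>.  But \<open>G = \<Omega> F\<close>, and twisting by \<open>F\<close> and then by \<open>\<Omega>\<close> is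
  twisting by \<open>\<Omega> F\<close> (\<open>twisted_coassociator_twist\<close>), so that \<open>\<Phi>\<^sub>G\<close> is the twist of \<open>\<Phi>\<^sub>F\<close> by \<open>\<Omega>\<close>.
\<close>

section \<open>Linear maps on tensor products\<close>

lemma clinear_iff:
  "clinear f \<longleftrightarrow> (\<forall>x y. f (x + y) = f x + f y) \<and> (\<forall>c x. f (c *\<^sub>C x) = c *\<^sub>C f x)"
proof
  assume "clinear f"
  then interpret Vector_Spaces.linear scaleC scaleC f .
  show "(\<forall>x y. f (x + y) = f x + f y) \<and> (\<forall>c x. f (c *\<^sub>C x) = c *\<^sub>C f x)"
    by (simp add: add scale)
next
  assume "(\<forall>x y. f (x + y) = f x + f y) \<and> (\<forall>c x. f (c *\<^sub>C x) = c *\<^sub>C f x)"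
  then show "clinear f"
    by unfold_locales auto
qed

lemma clinear_add: "clinear f \<Longrightarrow> f (x + y) = f x + f y"
  and clinear_scale: "clinear f \<Longrightarrow> f (c *\<^sub>C x) = c *\<^sub>C f x"
  by (simp_all add: clinear_iff)

lemma additive_zero:
  fixes f :: "'a::complex_vector \<Rightarrow> 'b::complex_vector"
  assumes "\<And>x y. f (x + y) = f x + f y"
  shows "f 0 = 0"
  using assms[of 0 0] by simp

lemma clinear_id [simp]: "clinear id" "clinear (\<lambda>x. x)"
  by (simp_all add: clinear_iff)

lemma clinear_compose: "clinear f \<Longrightarrow> clinear g \<Longrightarrow> clinear (\<lambda>x. f (g x))"
  by (simp add: clinear_iff)

lemma clinear_mult_right [simp]:
  fixes f :: "'a::complex_vector \<Rightarrow> 'b::complex_algebra_1"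
  shows "clinear f \<Longrightarrow> clinear (\<lambda>x. f x * c)"
  by (simp add: clinear_iff distrib_right mult_scaleC_left)

lemma clinear_mult_left [simp]:
  fixes f :: "'a::complex_vector \<Rightarrow> 'b::complex_algebra_1"
  shows "clinear f \<Longrightarrow> clinear (\<lambda>x. c * f x)"
  by (simp add: clinear_iff distrib_left mult_scaleC_right)

lemma tensor_ext:
  fixes f g :: "'a::complex_vector \<otimes> 'b::complex_vector \<Rightarrow> 'c::complex_vector"
  assumes f: "\<And>s t. f (s + t) = f s + f t" and g: "\<And>s t. g (s + t) = g s + g t"
    and eq: "\<And>a b. f (a \<otimes> b) = g (a \<otimes> b)"
  shows "f t = g t"
  by (induction t) (simp_all add: f g eq additive_zero[of f] additive_zero[of g])

definition cbilinear ::
  "('a::complex_vector \<Rightarrow> 'b::complex_vector \<Rightarrow> 'c::complex_vector) \<Rightarrow> bool"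
where "cbilinear g \<longleftrightarrow> (\<forall>x. clinear (g x)) \<and> (\<forall>y. clinear (\<lambda>x. g x y))"

lemma cbilinear_balanced:
  fixes g :: "'a::complex_vector \<Rightarrow> 'b::complex_vector \<Rightarrow> 'c::complex_vector"
  assumes "cbilinear g"
  shows "balanced g"
  using assms additive_zero[of "\<lambda>x. g x y" for y]
  by (auto simp: cbilinear_def balanced_def clinear_iff)

lemma cbilinear_tensor: "clinear f \<Longrightarrow> clinear g \<Longrightarrow> cbilinear (\<lambda>a b. f a \<otimes> g b)"
  by (simp add: cbilinear_def clinear_iff tensor_add_left tensor_add_right
      scaleC_tensor_left scaleC_tensor_right)

lemma clinear_tlift:
  fixes g :: "'a::complex_vector \<Rightarrow> 'b::complex_vector \<Rightarrow> 'c::complex_vector"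
  assumes "cbilinear g"
  shows "clinear (tlift g)"
proof -
  have b: "balanced g"
    by (rule cbilinear_balanced[OF assms])
  have "tlift g (c *\<^sub>C t) = c *\<^sub>C tlift g t" for c t
  proof (rule tensor_ext[of "\<lambda>t. tlift g (c *\<^sub>C t)" "\<lambda>t. c *\<^sub>C tlift g t"])
    fix a b
    have "tlift g (c *\<^sub>C (a \<otimes> b)) = g (c *\<^sub>C a) b"
      by (simp add: \<open>balanced g\<close> flip: scaleC_tensor_left)
    also have "\<dots> = c *\<^sub>C g a b"
      using assms by (simp add: cbilinear_def clinear_iff)
    finally show "tlift g (c *\<^sub>C (a \<otimes> b)) = c *\<^sub>C tlift g (a \<otimes> b)"
      by (simp add: \<open>balanced g\<close>)
  qed (simp_all add: b scaleC_add_right)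
  then show ?thesis
    by (simp add: clinear_iff b)
qed

text \<open>
  By definition \<^const>\<open>tlift\<close> sums over one fixed representative.  Every additive map can
  therefore be moved across it even when the summand is not balanced, which spares checking
  multilinearity at each step of a computation with nested sums over coproducts.
\<close>

lemma tlift_image:
  assumes "h 0 = 0" "\<And>x y. h (x + y) = h x + h y"
  shows "h (tlift g t) = tlift (\<lambda>a b. h (g a b)) t"
proof -
  have "h (\<Sum>(a, b)\<in>#M. g a b) = (\<Sum>(a, b)\<in>#M. h (g a b))" for M
    by (induction M) (use assms in \<open>auto split: prod.splits\<close>)
  then show ?thesis
    by (simp add: tlift_def)
qed

lemma clinear_image_tlift:
  "clinear h \<Longrightarrow> h (tlift g t) = tlift (\<lambda>a b. h (g a b)) t"
  by (rule tlift_image) (simp_all add: clinear_iff additive_zero)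

lemma tlift_plus: "tlift (\<lambda>a b. g a b + h a b) t = tlift g t + tlift h t"
proof -
  have "(\<Sum>(a, b)\<in>#M. g a b + h a b) = (\<Sum>(a, b)\<in>#M. g a b) + (\<Sum>(a, b)\<in>#M. h a b)" for M
    by (induction M) (auto simp: ac_simps)
  then show ?thesis
    by (simp add: tlift_def)
qed

lemma clinear_tlift_param:
  assumes "\<And>a b. clinear (\<lambda>x. g x a b)"
  shows "clinear (\<lambda>x. tlift (g x) t)"
proof -
  have "g (x + y) = (\<lambda>a b. g x a b + g y a b)" "g (c *\<^sub>C x) = (\<lambda>a b. c *\<^sub>C g x a b)" for c x y
    using assms by (simp_all add: fun_eq_iff clinear_iff)
  moreover have "tlift (\<lambda>a b. c *\<^sub>C g x a b) t = c *\<^sub>C tlift (g x) t" for c x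
    by (rule tlift_image[symmetric]) (simp_all add: scaleC_add_right)
  ultimately show ?thesis
    by (simp add: clinear_iff tlift_plus)
qed

lemma cbilinear_tlift:
  assumes "\<And>x. cbilinear (g x)" "\<And>y z. clinear (\<lambda>x. g x y z)"
  shows "cbilinear (\<lambda>x. tlift (g x))"
  using assms by (simp add: cbilinear_def[of "\<lambda>x. tlift (g x)"] clinear_tlift clinear_tlift_param)

lemma tlift_tensor_cbilinear: "cbilinear g \<Longrightarrow> tlift g (a \<otimes> b) = g a b"
  by (simp add: cbilinear_balanced)

lemma tmap_tensor [simp]: "clinear f \<Longrightarrow> clinear g \<Longrightarrow> tmap f g (a \<otimes> b) = f a \<otimes> g b"
  by (simp add: tmap_def tlift_tensor_cbilinear cbilinear_tensor)

lemma clinear_tmap [simp]: "clinear f \<Longrightarrow> clinear g \<Longrightarrow> clinear (tmap f g)"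
  by (simp add: tmap_def clinear_tlift cbilinear_tensor)

lemma clinear_tensor_left [simp]: "clinear f \<Longrightarrow> clinear (\<lambda>t. f t \<otimes> u)"
  and clinear_tensor_right [simp]: "clinear f \<Longrightarrow> clinear (\<lambda>t. u \<otimes> f t)"
  by (simp_all add: clinear_iff tensor_add_left tensor_add_right
      scaleC_tensor_left scaleC_tensor_right)

lemma cbilinear_tassoc: "cbilinear (\<lambda>s c. tlift (\<lambda>a b. a \<otimes> (b \<otimes> c)) s)"
  unfolding cbilinear_def
proof (intro conjI allI)
  show "clinear (\<lambda>s. tlift (\<lambda>a b. a \<otimes> (b \<otimes> c)) s)" for c
    by (rule clinear_tlift) (simp add: cbilinear_def)
  show "clinear (\<lambda>c. tlift (\<lambda>a b. a \<otimes> (b \<otimes> c)) s)" for s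
    by (rule clinear_tlift_param) simp
qed

lemma clinear_tassoc [simp]: "clinear tassoc"
  unfolding tassoc_def by (rule clinear_tlift[OF cbilinear_tassoc])

lemma tassoc_tensor [simp]: "tassoc ((a \<otimes> b) \<otimes> c) = a \<otimes> (b \<otimes> c)"
  by (simp add: tassoc_def tlift_tensor_cbilinear[OF cbilinear_tassoc]
      tlift_tensor_cbilinear cbilinear_def)

lemma cbilinear_scale: "clinear \<epsilon> \<Longrightarrow> cbilinear (\<lambda>a b. \<epsilon> a *\<^sub>C b)"
  by (simp add: cbilinear_def clinear_iff scaleC_add_left scaleC_add_right
      scaleC_scaleC scaleC_complex_def mult.commute)

lemma cbilinear_scale': "clinear \<epsilon> \<Longrightarrow> cbilinear (\<lambda>a b. \<epsilon> b *\<^sub>C a)"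
  by (simp add: cbilinear_def clinear_iff scaleC_add_left scaleC_add_right
      scaleC_scaleC scaleC_complex_def mult.commute)

lemma clinear_eps_left [simp]: "clinear \<epsilon> \<Longrightarrow> clinear (eps_left \<epsilon>)"
  unfolding eps_left_def by (intro clinear_tlift cbilinear_scale)

lemma clinear_eps_right [simp]: "clinear \<epsilon> \<Longrightarrow> clinear (eps_right \<epsilon>)"
  unfolding eps_right_def by (intro clinear_tlift cbilinear_scale')

lemma eps_left_tensor [simp]: "clinear \<epsilon> \<Longrightarrow> eps_left \<epsilon> (a \<otimes> b) = \<epsilon> a *\<^sub>C b"
  unfolding eps_left_def by (rule tlift_tensor_cbilinear[OF cbilinear_scale])

lemma eps_right_tensor [simp]: "clinear \<epsilon> \<Longrightarrow> eps_right \<epsilon> (a \<otimes> b) = \<epsilon> b *\<^sub>C a"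
  unfolding eps_right_def by (rule tlift_tensor_cbilinear[OF cbilinear_scale'])

lemma tlift_mult:
  fixes g :: "'a::complex_algebra_1 \<Rightarrow> 'b::complex_algebra_1 \<Rightarrow> 'c::complex_vector"
  assumes "cbilinear g"
  shows "tlift g (s * t) = tlift (\<lambda>a b. tlift (\<lambda>c d. g (a * c) (b * d)) t) s"
proof -
  have "tlift g (s * t) = tlift (\<lambda>a b. tlift (\<lambda>c d. tlift g ((a * c) \<otimes> (b * d))) t) s"
    by (simp add: times_tensor_def clinear_image_tlift[OF clinear_tlift[OF assms]])
  then show ?thesis
    by (simp add: tlift_tensor_cbilinear[OF assms])
qed

section \<open>Algebra homomorphisms\<close>

lemma algebra_homI:
  "clinear f \<Longrightarrow> (\<And>x y. f (x * y) = f x * f y) \<Longrightarrow> f 1 = 1 \<Longrightarrow> algebra_hom f"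
  by (simp add: algebra_hom_def)

lemma algebra_hom_clinear [simp]: "algebra_hom f \<Longrightarrow> clinear f"
  and algebra_hom_mult: "algebra_hom f \<Longrightarrow> f (x * y) = f x * f y"
  and algebra_hom_one: "algebra_hom f \<Longrightarrow> f 1 = 1"
  by (simp_all add: algebra_hom_def)

lemma algebra_hom_id [simp]: "algebra_hom id"
  by (simp add: algebra_hom_def)

lemma algebra_hom_compose: "algebra_hom f \<Longrightarrow> algebra_hom g \<Longrightarrow> algebra_hom (\<lambda>x. f (g x))"
  by (simp add: algebra_hom_def clinear_compose)

lemma mult_tensor_ext:
  fixes f :: "'a::complex_algebra_1 \<otimes> 'b::complex_algebra_1 \<Rightarrow> 'c::complex_algebra_1"
  assumes f: "clinear f"
    and mult: "\<And>a b c d. f ((a \<otimes> b) * (c \<otimes> d)) = f (a \<otimes> b) * f (c \<otimes> d)"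
  shows "f (s * t) = f s * f t"
proof (rule tensor_ext[of "\<lambda>s. f (s * t)" "\<lambda>s. f s * f t"])
  show "f ((a \<otimes> b) * t) = f (a \<otimes> b) * f t" for a b
    by (rule tensor_ext[of "\<lambda>t. f ((a \<otimes> b) * t)" "\<lambda>t. f (a \<otimes> b) * f t"])
      (simp_all only: distrib_left clinear_add[OF f] mult)
qed (simp_all only: distrib_right clinear_add[OF f])

lemma algebra_hom_tensorI:
  fixes f :: "'a::complex_algebra_1 \<otimes> 'b::complex_algebra_1 \<Rightarrow> 'c::complex_algebra_1"
  assumes "clinear f"
    and "\<And>a b c d. f ((a \<otimes> b) * (c \<otimes> d)) = f (a \<otimes> b) * f (c \<otimes> d)"
    and "f (1 \<otimes> 1) = 1"
  shows "algebra_hom f"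
  by (rule algebra_homI) (use assms in \<open>simp_all add: one_tensor_def mult_tensor_ext\<close>)

lemma algebra_hom_tmap [simp]:
  "algebra_hom f \<Longrightarrow> algebra_hom g \<Longrightarrow> algebra_hom (tmap f g)"
  by (rule algebra_hom_tensorI)
    (simp_all add: mult_tensor algebra_hom_mult algebra_hom_one one_tensor_def)

lemma tassoc_mult: "tassoc (s * t) = tassoc s * tassoc t"
proof (rule mult_tensor_ext[OF clinear_tassoc])
  fix s t :: "'a \<otimes> 'b" and c d :: 'c
  show "tassoc ((s \<otimes> c) * (t \<otimes> d)) = tassoc (s \<otimes> c) * tassoc (t \<otimes> d)"
    unfolding mult_tensor
  proof (rule tensor_ext[of "\<lambda>s. tassoc ((s * t) \<otimes> (c * d))"
        "\<lambda>s. tassoc (s \<otimes> c) * tassoc (t \<otimes> d)"])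
    fix a :: 'a and b :: 'b
    show "tassoc (((a \<otimes> b) * t) \<otimes> (c * d)) = tassoc ((a \<otimes> b) \<otimes> c) * tassoc (t \<otimes> d)"
      by (rule tensor_ext[of "\<lambda>t. tassoc (((a \<otimes> b) * t) \<otimes> (c * d))"
            "\<lambda>t. tassoc ((a \<otimes> b) \<otimes> c) * tassoc (t \<otimes> d)"])
        (simp_all add: distrib_left tensor_add_left clinear_add mult_tensor)
  qed (simp_all add: distrib_right tensor_add_left clinear_add)
qed

lemma algebra_hom_tassoc [simp]: "algebra_hom tassoc"
  by (rule algebra_homI) (simp_all add: tassoc_mult one_tensor_def)

lemma algebra_hom_eps_left [simp]: "algebra_hom \<epsilon> \<Longrightarrow> algebra_hom (eps_left \<epsilon>)"
  by (rule algebra_hom_tensorI)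
    (simp_all add: mult_tensor algebra_hom_mult algebra_hom_one mult_scaleC_left mult_scaleC_right
      scaleC_scaleC scaleC_one mult.commute[of "\<epsilon> _" "\<epsilon> _"])

lemma algebra_hom_eps_right [simp]: "algebra_hom \<epsilon> \<Longrightarrow> algebra_hom (eps_right \<epsilon>)"
  by (rule algebra_hom_tensorI)
    (simp_all add: mult_tensor algebra_hom_mult algebra_hom_one mult_scaleC_left mult_scaleC_right
      scaleC_scaleC scaleC_one mult.commute[of "\<epsilon> _" "\<epsilon> _"])

lemma mult_minv_cancel:
  assumes "invertible x"
  shows "x * (minv x * y) = y" "minv x * (x * y) = y"
  using minv_inverse[OF assms] by (simp_all flip: mult.assoc)

lemma invertibleI: "x * y = 1 \<Longrightarrow> y * x = 1 \<Longrightarrow> invertible x"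
  by (auto simp: invertible_def)

lemma invertible_mult: "invertible x \<Longrightarrow> invertible y \<Longrightarrow> invertible (x * y)"
  and minv_mult: "invertible x \<Longrightarrow> invertible y \<Longrightarrow> minv (x * y) = minv y * minv x"
proof -
  assume "invertible x" "invertible y"
  then have xy: "(x * y) * (minv y * minv x) = 1" "(minv y * minv x) * (x * y) = 1"
    by (simp_all add: mult.assoc mult_minv_cancel minv_inverse)
  then show "invertible (x * y)"
    by (rule invertibleI)
  show "minv (x * y) = minv y * minv x"
    using xy by (rule minv_unique)
qed

lemma invertible_minv: "invertible x \<Longrightarrow> invertible (minv x)"
  by (rule invertibleI[of _ x]) (simp_all add: minv_inverse)

lemma minv_minv: "invertible x \<Longrightarrow> minv (minv x) = x"
  by (rule minv_unique) (simp_all add: minv_inverse)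

lemma algebra_hom_minv:
  assumes "algebra_hom f" "invertible x"
  shows "invertible (f x)" "minv (f x) = f (minv x)"
proof -
  have "f x * f (minv x) = 1" "f (minv x) * f x = 1"
    using assms by (simp_all add: minv_inverse algebra_hom_one flip: algebra_hom_mult)
  then show "invertible (f x)" "minv (f x) = f (minv x)"
    by (rule invertibleI, rule minv_unique)
qed

section \<open>The antipode of a Hopf algebra\<close>

lemma cbilinear_mult: "cbilinear ((*) :: 'a::complex_algebra_1 \<Rightarrow> 'a \<Rightarrow> 'a)"
  by (simp add: cbilinear_def clinear_iff distrib_left distrib_right mult_scaleC_left mult_scaleC_right)

lemma tmult_tmap:
  "clinear f \<Longrightarrow> clinear g \<Longrightarrow> tmult (tmap f g t) = tlift (\<lambda>x y. f x * g y) t"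
  unfolding tmult_def tmap_def
  by (simp add: clinear_image_tlift[OF clinear_tlift[OF cbilinear_mult]]
      tlift_tensor_cbilinear[OF cbilinear_mult])

context hopf_algebra
begin

lemma clinear_comul [simp]: "clinear \<Delta>"
  using comul_hom by simp

lemma clinear_counit [simp]: "clinear \<epsilon>"
  using counit_hom by simp

lemma clinear_antipode [simp]: "clinear S"
  by (rule antipode_linear)

text \<open>
  Coassociativity in the form used in Sweedler notation: a trilinear expression may be evaluated
  at \<open>a\<^sub>1\<^sub>1, a\<^sub>1\<^sub>2, a\<^sub>2\<close> or at \<open>a\<^sub>1, a\<^sub>2\<^sub>1, a\<^sub>2\<^sub>2\<close>.
\<close>

lemma sweedler_coassoc:
  assumes "\<And>x. cbilinear (G x)" "\<And>y z. clinear (\<lambda>x. G x y z)"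
  shows "tlift (\<lambda>u z. tlift (\<lambda>x y. G x y z) (\<Delta> u)) (\<Delta> a) =
         tlift (\<lambda>x u. tlift (\<lambda>y z. G x y z) (\<Delta> u)) (\<Delta> a)"
proof -
  define T where "T = tlift (\<lambda>x. tlift (G x))"
  have bil: "cbilinear (\<lambda>x. tlift (G x))"
    by (rule cbilinear_tlift[OF assms])
  have T: "clinear T"
    unfolding T_def by (rule clinear_tlift[OF bil])
  have T_tensor: "T (x \<otimes> s) = tlift (G x) s" for x s
    unfolding T_def by (rule tlift_tensor_cbilinear[OF bil])
  have G: "tlift (G x) (y \<otimes> z) = G x y z" for x y z
    by (rule tlift_tensor_cbilinear[OF assms(1)])
  have "T (tassoc (s \<otimes> z)) = tlift (\<lambda>x y. G x y z) s" for s z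
    by (simp add: tassoc_def tlift_tensor_cbilinear[OF cbilinear_tassoc]
        clinear_image_tlift[OF T] T_tensor G)
  then have "T (tassoc (tmap \<Delta> id (\<Delta> a))) = tlift (\<lambda>u z. tlift (\<lambda>x y. G x y z) (\<Delta> u)) (\<Delta> a)"
    by (simp add: tmap_def clinear_image_tlift[OF T] clinear_image_tlift[OF clinear_tassoc])
  moreover have "T (tmap id \<Delta> (\<Delta> a)) = tlift (\<lambda>x u. tlift (\<lambda>y z. G x y z) (\<Delta> u)) (\<Delta> a)"
    by (simp add: tmap_def clinear_image_tlift[OF T] T_tensor)
  ultimately show ?thesis
    by (simp add: coassociative)
qed

text \<open>
  In the convolution algebra, if \<open>f * g = \<epsilon>\<close> and \<open>g * h = \<epsilon> c\<close>, then
  \<open>h = f * g * h = f * \<epsilon> c = f c\<close>.  With \<open>c = 1\<close> this is the uniqueness of convolution inverses;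
  the factor \<open>c\<close> makes it applicable to maps of two arguments with one of them held fixed.
\<close>

lemma convolution_cancel:
  fixes f g h :: "'h \<Rightarrow> 'b::complex_algebra_1"
  assumes f: "clinear f" and g: "clinear g" and h: "clinear h"
    and fg: "\<And>a. tlift (\<lambda>x y. f x * g y) (\<Delta> a) = \<epsilon> a *\<^sub>C 1"
    and gh: "\<And>a. tlift (\<lambda>x y. g x * h y) (\<Delta> a) = \<epsilon> a *\<^sub>C c"
  shows "h a = f a * c"
proof -
  have bil: "cbilinear (\<lambda>y z. f x * g y * h z)" "clinear (\<lambda>x. f x * g y * h z)" for x y z
    using f g h by (simp_all add: cbilinear_def)
  have "h a = h (eps_left \<epsilon> (\<Delta> a))"
    by (simp add: counit_left)
  also have "\<dots> = tlift (\<lambda>u z. (\<epsilon> u *\<^sub>C 1) * h z) (\<Delta> a)"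
    by (simp add: eps_left_def clinear_image_tlift[OF h] clinear_scale[OF h] mult_scaleC_left)
  also have "\<dots> = tlift (\<lambda>u z. tlift (\<lambda>x y. f x * g y * h z) (\<Delta> u)) (\<Delta> a)"
    unfolding fg[symmetric] by (simp add: clinear_image_tlift[of "\<lambda>w. w * h _"])
  also have "\<dots> = tlift (\<lambda>x u. tlift (\<lambda>y z. f x * g y * h z) (\<Delta> u)) (\<Delta> a)"
    by (rule sweedler_coassoc[OF bil])
  also have "\<dots> = tlift (\<lambda>x u. f x * (\<epsilon> u *\<^sub>C c)) (\<Delta> a)"
    unfolding gh[symmetric] by (simp add: clinear_image_tlift[of "\<lambda>w. f _ * w"] mult.assoc)
  also have "\<dots> = f (eps_right \<epsilon> (\<Delta> a)) * c"
    by (simp add: eps_right_def clinear_image_tlift[OF f] clinear_scale[OF f]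
        clinear_image_tlift[of "\<lambda>w. w * c"] mult_scaleC_left mult_scaleC_right)
  finally show ?thesis
    by (simp add: counit_right)
qed

lemma antipode_left_tlift: "tlift (\<lambda>x y. S x * y) (\<Delta> a) = \<epsilon> a *\<^sub>C 1"
  using antipode_left[of a] by (simp add: tmult_tmap)

lemma antipode_right_tlift: "tlift (\<lambda>x y. x * S y) (\<Delta> a) = \<epsilon> a *\<^sub>C 1"
  using antipode_right[of a] by (simp add: tmult_tmap)

text \<open>
  The usual proof compares two convolution inverses of the multiplication on the coalgebra
  \<open>H \<otimes> H\<close>.  Cancelling one argument at a time avoids that coalgebra: with \<open>b\<close> fixed,
  \<open>f(a) = \<Sum> b\<^sub>1 S(a b\<^sub>2)\<close> satisfies \<open>id * f = \<epsilon> \<epsilon>(b)\<close>, hence \<open>f(a) = \<epsilon>(b) S(a)\<close>; with \<open>a\<close> fixed, this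
  says that \<open>h(b) = S(a b)\<close> satisfies \<open>id * h = \<epsilon> S(a)\<close>, hence \<open>S(a b) = S(b) S(a)\<close>.
\<close>

lemma antipode_antihom: "algebra_antihom S"
proof -
  have cancel: "h a = S a * c"
    if "clinear h" "\<And>a. tlift (\<lambda>x y. x * h y) (\<Delta> a) = \<epsilon> a *\<^sub>C c" for h a c
    using that by (intro convolution_cancel[of S "\<lambda>x. x" h]) (simp_all add: antipode_left_tlift)
  have bil: "cbilinear (\<lambda>x y. x * S y)"
    by (simp add: cbilinear_def)
  have inner: "tlift (\<lambda>b1 b2. b1 * S (a * b2)) (\<Delta> b) = \<epsilon> b *\<^sub>C S a" for a b
  proof -
    have "tlift (\<lambda>b1 b2. b1 * S (a * b2)) (\<Delta> b) = S a * (\<epsilon> b *\<^sub>C 1)"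
    proof (rule cancel[of "\<lambda>a. tlift (\<lambda>b1 b2. b1 * S (a * b2)) (\<Delta> b)"])
      show "clinear (\<lambda>a. tlift (\<lambda>b1 b2. b1 * S (a * b2)) (\<Delta> b))"
        by (intro clinear_tlift_param clinear_mult_left clinear_compose[OF clinear_antipode]) simp
      fix a
      have "tlift (\<lambda>x y. x * tlift (\<lambda>b1 b2. b1 * S (y * b2)) (\<Delta> b)) (\<Delta> a) =
          tlift (\<lambda>x y. x * S y) (\<Delta> a * \<Delta> b)"
        by (simp add: tlift_mult[OF bil] clinear_image_tlift[of "\<lambda>w. _ * w"] mult.assoc)
      also have "\<dots> = \<epsilon> (a * b) *\<^sub>C 1"
        by (simp add: antipode_right_tlift flip: algebra_hom_mult[OF comul_hom])
      also have "\<dots> = \<epsilon> a *\<^sub>C \<epsilon> b *\<^sub>C 1"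
        by (simp add: algebra_hom_mult[OF counit_hom] scaleC_scaleC)
      finally show "tlift (\<lambda>x y. x * tlift (\<lambda>b1 b2. b1 * S (y * b2)) (\<Delta> b)) (\<Delta> a) =
        \<epsilon> a *\<^sub>C \<epsilon> b *\<^sub>C 1" .
    qed
    then show ?thesis
      by (simp add: mult_scaleC_right)
  qed
  have "S (a * b) = S b * S a" for a b
    by (rule cancel[of "\<lambda>b. S (a * b)", OF clinear_compose[OF clinear_antipode] inner]) simp
  moreover have "S 1 = 1"
  proof -
    have "S 1 * 1 = tlift (\<lambda>x y. S x * y) (\<Delta> 1)"
      using tlift_tensor_cbilinear[of "\<lambda>x y. S x * y" 1 1]
      by (simp add: cbilinear_def algebra_hom_one[OF comul_hom] one_tensor_def)
    then show ?thesis
      by (simp add: antipode_left_tlift algebra_hom_one[OF counit_hom] scaleC_one)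
  qed
  ultimately show ?thesis
    by (simp add: algebra_antihom_def)
qed

lemma antipode_mult: "S (a * b) = S b * S a"
  and antipode_one: "S 1 = 1"
  using antipode_antihom by (simp_all add: algebra_antihom_def)

end


section \<open>Embeddings into higher tensor powers\<close>

lemma clinear_ext2:
  fixes f g :: "'a::complex_vector \<otimes> 'b::complex_vector \<Rightarrow> 'c::complex_vector"
  assumes "clinear f" "clinear g" "\<And>a b. f (a \<otimes> b) = g (a \<otimes> b)"
  shows "f t = g t"
  by (rule tensor_ext[of f g]) (use assms in \<open>simp_all add: clinear_add\<close>)

lemma clinear_ext3:
  fixes f g :: "'a::complex_vector \<otimes> 'b::complex_vector \<otimes> 'c::complex_vector \<Rightarrow> 'd::complex_vector"
  assumes "clinear f" "clinear g" "\<And>a b c. f (a \<otimes> b \<otimes> c) = g (a \<otimes> b \<otimes> c)"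
  shows "f t = g t"
proof (rule clinear_ext2[OF assms(1,2)])
  show "f (a \<otimes> s) = g (a \<otimes> s)" for a s
    by (rule clinear_ext2[of "\<lambda>s. f (a \<otimes> s)" "\<lambda>s. g (a \<otimes> s)"])
      (use assms in \<open>simp_all add: clinear_compose[of f] clinear_compose[of g]\<close>)
qed

lemma clinear_ext22:
  fixes f g :: "'a::complex_vector \<otimes> 'b::complex_vector \<Rightarrow> 'c::complex_vector \<otimes> 'd::complex_vector \<Rightarrow>
    'e::complex_vector"
  assumes "\<And>t. clinear (\<lambda>s. f s t)" "\<And>t. clinear (\<lambda>s. g s t)"
    and "\<And>s. clinear (f s)" "\<And>s. clinear (g s)"
    and "\<And>a b c d. f (a \<otimes> b) (c \<otimes> d) = g (a \<otimes> b) (c \<otimes> d)"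
  shows "f s t = g s t"
  by (rule clinear_ext2[of "\<lambda>s. f s t" "\<lambda>s. g s t", OF assms(1,2)])
    (rule clinear_ext2[OF assms(3,4,5)])

lemma clinear_ext23:
  fixes f g :: "'a::complex_vector \<otimes> 'b::complex_vector \<Rightarrow>
    'c::complex_vector \<otimes> 'd::complex_vector \<otimes> 'e::complex_vector \<Rightarrow> 'f::complex_vector"
  assumes "\<And>t. clinear (\<lambda>s. f s t)" "\<And>t. clinear (\<lambda>s. g s t)"
    and "\<And>s. clinear (f s)" "\<And>s. clinear (g s)"
    and "\<And>a b c d e. f (a \<otimes> b) (c \<otimes> d \<otimes> e) = g (a \<otimes> b) (c \<otimes> d \<otimes> e)"
  shows "f s t = g s t"
  by (rule clinear_ext2[of "\<lambda>s. f s t" "\<lambda>s. g s t", OF assms(1,2)])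
    (rule clinear_ext3[OF assms(3,4,5)])

lemma clinear_tassoc_comp [simp]: "clinear f \<Longrightarrow> clinear (\<lambda>x. tassoc (f x))"
  by (rule clinear_compose) simp_all

lemma clinear_tmap_comp [simp]:
  "clinear g \<Longrightarrow> clinear h \<Longrightarrow> clinear f \<Longrightarrow> clinear (\<lambda>x. tmap g h (f x))"
  by (rule clinear_compose) simp_all

definition leg12 :: "'a::complex_algebra_1 \<otimes> 'b::complex_algebra_1 \<Rightarrow> 'a \<otimes> 'b \<otimes> 'c::complex_algebra_1"
  where "leg12 t = tassoc (t \<otimes> (1 :: 'c))"

text \<open>
  The second factor may itself be a tensor power, so iterating this map shifts an element
  further to the right, and \<open>leg23 (leg23 u)\<close> is \<open>1 \<otimes> 1 \<otimes> u\<close>.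
\<close>

definition leg23 :: "'b::complex_algebra_1 \<Rightarrow> 'a::complex_algebra_1 \<otimes> 'b"
  where "leg23 t = 1 \<otimes> t"

definition comul1 ::
  "('a::complex_vector \<Rightarrow> 'b::complex_vector \<otimes> 'c::complex_vector) \<Rightarrow>
    'a \<otimes> 'd::complex_vector \<Rightarrow> 'b \<otimes> 'c \<otimes> 'd"
  where "comul1 D = (\<lambda>t. tassoc (tmap D id t))"

lemma algebra_hom_leg23 [simp]: "algebra_hom leg23"
  by (rule algebra_homI) (simp_all add: leg23_def mult_tensor one_tensor_def clinear_iff
      tensor_add_right scaleC_tensor_right)

lemma algebra_hom_leg12 [simp]: "algebra_hom leg12"
proof (rule algebra_homI)
  show "clinear leg12"
    unfolding leg12_def by (rule clinear_compose) simp_all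
  show "leg12 (s * t) = leg12 s * leg12 t" for s t :: "'a \<otimes> 'b"
    by (simp add: leg12_def mult_tensor flip: tassoc_mult)
qed (simp add: leg12_def one_tensor_def)

lemma clinear_comul1 [simp]: "clinear D \<Longrightarrow> clinear (comul1 D)"
  unfolding comul1_def by (rule clinear_compose) simp_all

lemma algebra_hom_comul1 [simp]: "algebra_hom D \<Longrightarrow> algebra_hom (comul1 D)"
  unfolding comul1_def by (rule algebra_hom_compose) simp_all

lemma clinear_leg12_comp [simp]: "clinear f \<Longrightarrow> clinear (\<lambda>x. leg12 (f x))"
  by (rule clinear_compose) simp_all

lemma clinear_comul1_comp [simp]: "clinear D \<Longrightarrow> clinear f \<Longrightarrow> clinear (\<lambda>x. comul1 D (f x))"
  by (rule clinear_compose) simp_all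

lemma leg12_tensor: "leg12 (a \<otimes> b) = a \<otimes> b \<otimes> 1"
  by (simp add: leg12_def)

lemma comul1_tensor: "clinear D \<Longrightarrow> comul1 D (a \<otimes> b) = tassoc (D a \<otimes> b)"
  by (simp add: comul1_def)

lemma tassoc_tensor_right: "tassoc (s \<otimes> b) = leg12 s * (1 \<otimes> 1 \<otimes> b)"
proof -
  have "tassoc (s \<otimes> b) = tassoc ((s \<otimes> 1) * ((1 \<otimes> 1) \<otimes> b))"
    by (simp add: mult_tensor flip: one_tensor_def)
  then show ?thesis
    by (simp only: tassoc_mult leg12_def tassoc_tensor)
qed

lemma tassoc_tensor_left: "tassoc (s \<otimes> b) = (1 \<otimes> 1 \<otimes> b) * leg12 s"
proof -
  have "tassoc (s \<otimes> b) = tassoc (((1 \<otimes> 1) \<otimes> b) * (s \<otimes> 1))"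
    by (simp add: mult_tensor flip: one_tensor_def)
  then show ?thesis
    by (simp only: tassoc_mult leg12_def tassoc_tensor)
qed

lemma tmap_conjugate_right:
  assumes "clinear g"
  shows "tmap id (\<lambda>a. x * g a * y) t = leg23 x * tmap id g t * leg23 y"
  by (rule clinear_ext2[of "tmap id (\<lambda>a. x * g a * y)" "\<lambda>t. leg23 x * tmap id g t * leg23 y"])
    (use assms in \<open>simp_all add: leg23_def mult_tensor\<close>)

lemma comul1_conjugate:
  assumes "clinear D"
  shows "comul1 (\<lambda>a. x * D a * y) t = leg12 x * comul1 D t * leg12 y"
proof (rule clinear_ext2[of "comul1 (\<lambda>a. x * D a * y)" "\<lambda>t. leg12 x * comul1 D t * leg12 y"])
  show "comul1 (\<lambda>a. x * D a * y) (a \<otimes> b) = leg12 x * comul1 D (a \<otimes> b) * leg12 y" for a b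
    using assms
    by (simp add: comul1_tensor leg12_def mult_tensor flip: tassoc_mult)
qed (use assms in simp_all)

text \<open>The pentagon for rebracketing itself.\<close>

lemma tassoc_tassoc: "tmap id tassoc (tassoc (tassoc (s \<otimes> b) \<otimes> c)) = tassoc (s \<otimes> b \<otimes> c)"
  by (rule clinear_ext2[of "\<lambda>s. tmap id tassoc (tassoc (tassoc (s \<otimes> b) \<otimes> c))"
      "\<lambda>s. tassoc (s \<otimes> b \<otimes> c)"])
    simp_all

text \<open>
  In the fourfold tensor power these elements occupy disjoint factors.  This is the only
  commutation that the pentagon needs.
\<close>

lemma leg12_leg23_commute: "leg12 s * leg23 (leg23 t) = leg23 (leg23 t) * leg12 s"
  by (rule clinear_ext2[of "\<lambda>s. leg12 s * leg23 (leg23 t)"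
      "\<lambda>s. leg23 (leg23 t) * leg12 s"])
    (simp_all add: leg12_tensor leg23_def mult_tensor)

text \<open>The element \<open>t \<otimes> 1\<close> of the fourfold power; the inner rebracketing flattens its second factor.\<close>

definition leg123 ::
  "'a::complex_algebra_1 \<otimes> 'b::complex_algebra_1 \<otimes> 'c::complex_algebra_1 \<Rightarrow>
    'a \<otimes> 'b \<otimes> 'c \<otimes> 'd::complex_algebra_1"
  where "leg123 t = tmap id tassoc (leg12 t)"

lemma algebra_hom_leg123 [simp]: "algebra_hom leg123"
  unfolding leg123_def by (rule algebra_hom_compose[of "tmap id tassoc"]) simp_all

lemma clinear_leg123_comp [simp]: "clinear f \<Longrightarrow> clinear (\<lambda>x. leg123 (f x))"
  by (rule clinear_compose) simp_all

lemma leg123_leg12: "leg123 (leg12 u) = leg12 u"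
  by (rule clinear_ext2[of "\<lambda>u. leg123 (leg12 u)"
      "\<lambda>u. leg12 u"])
    (simp_all add: leg123_def leg12_tensor one_tensor_def)

lemma leg123_leg23: "leg123 (leg23 u) = leg23 (leg12 u)"
  by (simp add: leg123_def leg23_def leg12_def)

lemma leg123_tassoc: "leg123 (tassoc (s \<otimes> b)) = tassoc (s \<otimes> (b \<otimes> 1))"
  by (simp add: leg123_def leg12_def tassoc_tassoc)

lemma leg123_comul1: "clinear D \<Longrightarrow> leg123 (comul1 D u) = comul1 D (leg12 u)"
  by (rule clinear_ext2[of "\<lambda>u. leg123 (comul1 D u)"
      "\<lambda>u. comul1 D (leg12 u)"])
    (simp_all add: comul1_tensor leg123_tassoc leg12_tensor)

lemma leg123_tmap: "clinear D \<Longrightarrow> leg123 (tmap id D u) = tmap id (comul1 D) (leg12 u)"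
  by (rule clinear_ext2[of "\<lambda>u. leg123 (tmap id D u)"
      "\<lambda>u. tmap id (comul1 D) (leg12 u)"])
    (simp_all add: comul1_tensor leg123_def leg12_def)

lemma comul1_leg23: "algebra_hom D \<Longrightarrow> comul1 D (leg23 u) = leg23 (leg23 u)"
  by (simp add: leg23_def comul1_tensor algebra_hom_one one_tensor_def)

lemma tmap_leg23: "clinear g \<Longrightarrow> tmap id g (leg23 u) = leg23 (g u)"
  by (simp add: leg23_def)

lemma tmap_tmap_leg12: "algebra_hom D \<Longrightarrow> tmap id (tmap id D) (leg12 u) = leg12 u"
  by (rule clinear_ext2[of "\<lambda>u. tmap id (tmap id D) (leg12 u)"
      "\<lambda>u. leg12 u"])
    (simp_all add: leg12_tensor algebra_hom_one)

lemma tmap_tmap_tassoc: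
  "clinear D \<Longrightarrow> tmap id (tmap id D) (tassoc (s \<otimes> b)) = tassoc (s \<otimes> D b)"
  by (rule clinear_ext2[of "\<lambda>s. tmap id (tmap id D) (tassoc (s \<otimes> b))"
      "\<lambda>s. tassoc (s \<otimes> D b)"])
    simp_all

lemma comul1_tmap: "clinear D \<Longrightarrow> comul1 D (tmap id D u) = tmap id (tmap id D) (comul1 D u)"
  by (rule clinear_ext2[of "\<lambda>u. comul1 D (tmap id D u)"
      "\<lambda>u. tmap id (tmap id D) (comul1 D u)"])
    (simp_all add: comul1_tensor tmap_tmap_tassoc)

lemma comul1_tassoc:
  "clinear D \<Longrightarrow> comul1 D (tassoc (s \<otimes> b)) = tmap id tassoc (tassoc (comul1 D s \<otimes> b))"
  by (rule clinear_ext2[of "\<lambda>s. comul1 D (tassoc (s \<otimes> b))"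
      "\<lambda>s. tmap id tassoc (tassoc (comul1 D s \<otimes> b))"])
    (simp_all add: comul1_tensor tassoc_tassoc)

lemma tmap_comul1_tassoc:
  "clinear D \<Longrightarrow> tmap id (comul1 D) (tassoc (s \<otimes> b)) = tmap id tassoc (tassoc (tmap id D s \<otimes> b))"
  by (rule clinear_ext2[of "\<lambda>s. tmap id (comul1 D) (tassoc (s \<otimes> b))"
      "\<lambda>s. tmap id tassoc (tassoc (tmap id D s \<otimes> b))"])
    (simp_all add: comul1_tensor)

context hopf_algebra
begin

lemma algebra_hom_comul [simp]: "algebra_hom \<Delta>"
  by (rule comul_hom)

lemma algebra_hom_counit [simp]: "algebra_hom \<epsilon>"
  by (rule counit_hom)

lemma comul1_comul: "comul1 \<Delta> (\<Delta> a) = tmap id \<Delta> (\<Delta> a)"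
  by (simp add: comul1_def coassociative)

lemma comul1_comul1: "comul1 \<Delta> (comul1 \<Delta> u) = tmap id (comul1 \<Delta>) (comul1 \<Delta> u)"
  by (rule clinear_ext2[of "\<lambda>u. comul1 \<Delta> (comul1 \<Delta> u)"
      "\<lambda>u. tmap id (comul1 \<Delta>) (comul1 \<Delta> u)"])
    (simp_all add: comul1_tensor comul1_tassoc tmap_comul1_tassoc comul1_comul)

lemma tmap_tmap_comul: "tmap id (tmap id \<Delta>) (tmap id \<Delta> u) = tmap id (comul1 \<Delta>) (tmap id \<Delta> u)"
  by (rule clinear_ext2[of "\<lambda>u. tmap id (tmap id \<Delta>) (tmap id \<Delta> u)"
      "\<lambda>u. tmap id (comul1 \<Delta>) (tmap id \<Delta> u)"])
    (simp_all add: comul1_comul)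

end

section \<open>The antipode axioms under twisting\<close>

context hopf_algebra
begin

text \<open>
  A right and a left action of the algebra \<open>H \<otimes> H\<close> on \<open>H\<close>, by \<open>left_action_mult\<close> and
  \<open>right_action_mult\<close>; the names refer to the position of the antipode.  The elements \<open>\<alpha>\<close> and \<open>\<beta>\<close>
  of a twisted algebra are images of \<open>1\<close> under these actions, and the Hopf antipode axioms say
  that coproducts act on \<open>1\<close> as scalars.
\<close>

definition left_action :: "'h \<otimes> 'h \<Rightarrow> 'h \<Rightarrow> 'h"
  where "left_action u \<alpha> = tlift (\<lambda>p q. S p * \<alpha> * q) u"

definition right_action :: "'h \<otimes> 'h \<Rightarrow> 'h \<Rightarrow> 'h"
  where "right_action u \<beta> = tlift (\<lambda>p q. p * \<beta> * S q) u"

text \<open>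
  The functionals that occur in the two antipode conditions on a co-associator and its inverse,
  with \<open>\<alpha>\<close> and \<open>\<beta>\<close> as parameters: multiplying the argument on an outer side by an element of two
  adjacent legs only moves that element into one of the parameters.
\<close>

definition zig :: "'h \<Rightarrow> 'h \<Rightarrow> 'h \<otimes> 'h \<otimes> 'h \<Rightarrow> 'h"
  where "zig \<alpha> \<beta> = tlift (\<lambda>x. tlift (\<lambda>y z. S x * \<alpha> * y * \<beta> * S z))"

definition zag :: "'h \<Rightarrow> 'h \<Rightarrow> 'h \<otimes> 'h \<otimes> 'h \<Rightarrow> 'h"
  where "zag \<alpha> \<beta> = tlift (\<lambda>x. tlift (\<lambda>y z. x * \<beta> * S y * \<alpha> * z))"

lemma cbilinear_actions:
  "cbilinear (\<lambda>p q. S p * \<alpha> * q)" "cbilinear (\<lambda>p q. p * \<beta> * S q)"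
  by (simp_all add: cbilinear_def)

lemma cbilinear_zig: "cbilinear (\<lambda>y z. S x * \<alpha> * y * \<beta> * S z)"
  "cbilinear (\<lambda>x. tlift (\<lambda>y z. S x * \<alpha> * y * \<beta> * S z))"
proof -
  show *: "cbilinear (\<lambda>y z. S x * \<alpha> * y * \<beta> * S z)" for x
    by (simp add: cbilinear_def)
  show "cbilinear (\<lambda>x. tlift (\<lambda>y z. S x * \<alpha> * y * \<beta> * S z))"
    by (rule cbilinear_tlift[OF *]) simp
qed

lemma cbilinear_zag: "cbilinear (\<lambda>y z. x * \<beta> * S y * \<alpha> * z)"
  "cbilinear (\<lambda>x. tlift (\<lambda>y z. x * \<beta> * S y * \<alpha> * z))"
proof -
  show *: "cbilinear (\<lambda>y z. x * \<beta> * S y * \<alpha> * z)" for x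
    by (simp add: cbilinear_def)
  show "cbilinear (\<lambda>x. tlift (\<lambda>y z. x * \<beta> * S y * \<alpha> * z))"
    by (rule cbilinear_tlift[OF *]) simp
qed

lemma left_action_tensor [simp]: "left_action (p \<otimes> q) \<alpha> = S p * \<alpha> * q"
  and right_action_tensor [simp]: "right_action (p \<otimes> q) \<beta> = p * \<beta> * S q"
  by (simp_all add: left_action_def right_action_def tlift_tensor_cbilinear[OF cbilinear_actions(1)]
      tlift_tensor_cbilinear[OF cbilinear_actions(2)])

lemma zig_tensor [simp]: "zig \<alpha> \<beta> (x \<otimes> y \<otimes> z) = S x * \<alpha> * y * \<beta> * S z"
  by (simp add: zig_def tlift_tensor_cbilinear[OF cbilinear_zig(1)]
      tlift_tensor_cbilinear[OF cbilinear_zig(2)])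

lemma zag_tensor [simp]: "zag \<alpha> \<beta> (x \<otimes> y \<otimes> z) = x * \<beta> * S y * \<alpha> * z"
  by (simp add: zag_def tlift_tensor_cbilinear[OF cbilinear_zag(1)]
      tlift_tensor_cbilinear[OF cbilinear_zag(2)])

lemma clinear_actions [simp]:
  "clinear (\<lambda>u. left_action u \<alpha>)" "clinear (\<lambda>u. right_action u \<beta>)"
  "clinear (left_action u)" "clinear (right_action u)"
proof -
  show "clinear (\<lambda>u. left_action u \<alpha>)" "clinear (\<lambda>u. right_action u \<beta>)"
    unfolding left_action_def right_action_def
    by (intro clinear_tlift cbilinear_actions)+
  show "clinear (left_action u)" "clinear (right_action u)"
    unfolding left_action_def right_action_def by (intro clinear_tlift_param, simp)+
qed

lemma clinear_zig [simp]: "clinear (zig \<alpha> \<beta>)"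
  unfolding zig_def by (rule clinear_tlift[OF cbilinear_zig(2)])

lemma clinear_zag [simp]: "clinear (zag \<alpha> \<beta>)"
  unfolding zag_def by (rule clinear_tlift[OF cbilinear_zag(2)])

lemma clinear_zig_params: "clinear (\<lambda>\<alpha>. zig \<alpha> \<beta> t)" "clinear (\<lambda>\<beta>. zig \<alpha> \<beta> t)"
  unfolding zig_def by (intro clinear_tlift_param, simp)+

lemma clinear_zag_params: "clinear (\<lambda>\<alpha>. zag \<alpha> \<beta> t)" "clinear (\<lambda>\<beta>. zag \<alpha> \<beta> t)"
  unfolding zag_def by (intro clinear_tlift_param, simp)+

lemmas clinear_composites =
  clinear_compose[OF clinear_zig] clinear_compose[OF clinear_zag]
  clinear_compose[OF clinear_zig_params(1)] clinear_compose[OF clinear_zig_params(2)]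
  clinear_compose[OF clinear_zag_params(1)] clinear_compose[OF clinear_zag_params(2)]
  clinear_compose[OF clinear_antipode] clinear_compose[OF clinear_actions(1)]
  clinear_compose[OF clinear_actions(2)]
  clinear_compose[OF clinear_actions(3)] clinear_compose[OF clinear_actions(4)]

lemma left_action_mult: "left_action (u * v) \<alpha> = left_action v (left_action u \<alpha>)"
  by (rule clinear_ext22[of "\<lambda>u v. left_action (u * v) \<alpha>"
      "\<lambda>u v. left_action v (left_action u \<alpha>)"])
    (simp_all add: clinear_composites mult_tensor antipode_mult mult.assoc)

lemma right_action_mult: "right_action (u * v) \<beta> = right_action u (right_action v \<beta>)"
  by (rule clinear_ext22[of "\<lambda>u v. right_action (u * v) \<beta>"
      "\<lambda>u v. right_action u (right_action v \<beta>)"])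
    (simp_all add: clinear_composites mult_tensor antipode_mult mult.assoc)

lemma left_action_one: "left_action 1 \<alpha> = \<alpha>"
  and right_action_one: "right_action 1 \<beta> = \<beta>"
  by (simp_all add: one_tensor_def antipode_one)

lemma left_action_comul: "left_action (\<Delta> a) 1 = \<epsilon> a *\<^sub>C 1"
  and right_action_comul: "right_action (\<Delta> a) 1 = \<epsilon> a *\<^sub>C 1"
  by (simp_all add: left_action_def right_action_def antipode_left_tlift antipode_right_tlift)

lemma zig_leg12: "zig \<alpha> \<beta> (leg12 u * t) = zig (left_action u \<alpha>) \<beta> t"
  by (rule clinear_ext23[of "\<lambda>u t. zig \<alpha> \<beta> (leg12 u * t)"
      "\<lambda>u t. zig (left_action u \<alpha>) \<beta> t"])
    (simp_all add: clinear_composites mult_tensor antipode_mult mult.assoc leg12_tensor)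

lemma zig_leg23: "zig \<alpha> \<beta> (t * leg23 u) = zig \<alpha> (right_action u \<beta>) t"
  by (rule clinear_ext23[of "\<lambda>u t. zig \<alpha> \<beta> (t * leg23 u)"
      "\<lambda>u t. zig \<alpha> (right_action u \<beta>) t"])
    (simp_all add: clinear_composites mult_tensor antipode_mult mult.assoc leg23_def)

lemma zag_leg23: "zag \<alpha> \<beta> (leg23 u * t) = zag (left_action u \<alpha>) \<beta> t"
  by (rule clinear_ext23[of "\<lambda>u t. zag \<alpha> \<beta> (leg23 u * t)"
      "\<lambda>u t. zag (left_action u \<alpha>) \<beta> t"])
    (simp_all add: clinear_composites mult_tensor antipode_mult mult.assoc leg23_def)

lemma zag_leg12: "zag \<alpha> \<beta> (t * leg12 u) = zag \<alpha> (right_action u \<beta>) t"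
  by (rule clinear_ext23[of "\<lambda>u t. zag \<alpha> \<beta> (t * leg12 u)"
      "\<lambda>u t. zag \<alpha> (right_action u \<beta>) t"])
    (simp_all add: clinear_composites mult_tensor antipode_mult mult.assoc leg12_tensor)

lemma zig_third: "zig \<alpha> \<beta> ((1 \<otimes> 1 \<otimes> b) * t) = zig \<alpha> \<beta> t * S b"
  by (rule clinear_ext3[of "\<lambda>t. zig \<alpha> \<beta> ((1 \<otimes> 1 \<otimes> b) * t)" "\<lambda>t. zig \<alpha> \<beta> t * S b"])
    (simp_all add: clinear_composites mult_tensor antipode_mult mult.assoc)

lemma zig_first: "zig \<alpha> \<beta> (t * (a \<otimes> 1)) = S a * zig \<alpha> \<beta> t"
  by (rule clinear_ext3[of "\<lambda>t. zig \<alpha> \<beta> (t * (a \<otimes> 1))" "\<lambda>t. S a * zig \<alpha> \<beta> t"])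
    (simp_all add: clinear_composites mult_tensor antipode_mult mult.assoc)

lemma zag_first: "zag \<alpha> \<beta> ((a \<otimes> 1) * t) = a * zag \<alpha> \<beta> t"
  by (rule clinear_ext3[of "\<lambda>t. zag \<alpha> \<beta> ((a \<otimes> 1) * t)" "\<lambda>t. a * zag \<alpha> \<beta> t"])
    (simp_all add: clinear_composites mult_tensor mult.assoc)

lemma zag_third: "zag \<alpha> \<beta> (t * (1 \<otimes> 1 \<otimes> b)) = zag \<alpha> \<beta> t * b"
  by (rule clinear_ext3[of "\<lambda>t. zag \<alpha> \<beta> (t * (1 \<otimes> 1 \<otimes> b))" "\<lambda>t. zag \<alpha> \<beta> t * b"])
    (simp_all add: clinear_composites mult_tensor mult.assoc)

lemma leg_split:
  fixes a :: "'a::complex_algebra_1" and s :: "'b::complex_algebra_1"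
  shows "a \<otimes> s = (a \<otimes> 1) * leg23 s" and "a \<otimes> s = leg23 s * (a \<otimes> 1)"
  by (simp_all add: leg23_def mult_tensor)

text \<open>
  Factor \<open>\<Delta>(a) \<otimes> b\<close> as \<open>\<Delta>(a) \<otimes> 1\<close> times \<open>1 \<otimes> 1 \<otimes> b\<close>.  The first acts on the parameter \<open>1\<close> as the
  scalar \<open>\<epsilon>(a)\<close>, the second pulls out.  The three lemmas after this one are mirror images.
\<close>

lemma zig_comul1: "zig 1 1 (comul1 \<Delta> u * t) = zig 1 1 t * S (eps_left \<epsilon> u)"
proof (rule clinear_ext2[of "\<lambda>u. zig 1 1 (comul1 \<Delta> u * t)" "\<lambda>u. zig 1 1 t * S (eps_left \<epsilon> u)"])
  show "zig 1 1 (comul1 \<Delta> (a \<otimes> b) * t) = zig 1 1 t * S (eps_left \<epsilon> (a \<otimes> b))" for a b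
    by (simp add: comul1_tensor tassoc_tensor_right mult.assoc zig_leg12 left_action_comul
        clinear_scale[OF clinear_zig_params(1)] clinear_scale[OF clinear_antipode] zig_third
        mult_scaleC_left mult_scaleC_right)
qed (simp_all add: clinear_composites)

lemma zig_tmap_comul: "zig 1 1 (t * tmap id \<Delta> u) = S (eps_right \<epsilon> u) * zig 1 1 t"
proof (rule clinear_ext2[of "\<lambda>u. zig 1 1 (t * tmap id \<Delta> u)" "\<lambda>u. S (eps_right \<epsilon> u) * zig 1 1 t"])
  show "zig 1 1 (t * tmap id \<Delta> (a \<otimes> b)) = S (eps_right \<epsilon> (a \<otimes> b)) * zig 1 1 t" for a b
    by (simp add: leg_split(1)[of a "\<Delta> b"] zig_leg23 right_action_comul
        clinear_scale[OF clinear_zig_params(2)] clinear_scale[OF clinear_antipode] zig_first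
        mult_scaleC_left mult_scaleC_right flip: mult.assoc)
qed (simp_all add: clinear_composites)

lemma zag_tmap_comul: "zag 1 1 (tmap id \<Delta> u * t) = eps_right \<epsilon> u * zag 1 1 t"
proof (rule clinear_ext2[of "\<lambda>u. zag 1 1 (tmap id \<Delta> u * t)" "\<lambda>u. eps_right \<epsilon> u * zag 1 1 t"])
  show "zag 1 1 (tmap id \<Delta> (a \<otimes> b) * t) = eps_right \<epsilon> (a \<otimes> b) * zag 1 1 t" for a b
    by (simp add: leg_split(2)[of a "\<Delta> b"] mult.assoc zag_leg23 left_action_comul
        clinear_scale[OF clinear_zag_params(1)] zag_first mult_scaleC_left mult_scaleC_right)
qed (simp_all add: clinear_composites)

lemma zag_comul1: "zag 1 1 (t * comul1 \<Delta> u) = zag 1 1 t * eps_left \<epsilon> u"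
proof (rule clinear_ext2[of "\<lambda>u. zag 1 1 (t * comul1 \<Delta> u)" "\<lambda>u. zag 1 1 t * eps_left \<epsilon> u"])
  show "zag 1 1 (t * comul1 \<Delta> (a \<otimes> b)) = zag 1 1 t * eps_left \<epsilon> (a \<otimes> b)" for a b
    by (simp add: comul1_tensor tassoc_tensor_left zag_leg12 right_action_comul
        clinear_scale[OF clinear_zag_params(2)] zag_third mult_scaleC_left mult_scaleC_right flip: mult.assoc)
qed (simp_all add: clinear_composites)

end

section \<open>Twisting a Hopf algebra\<close>

text \<open>
  The co-associator of two successive twists.  The coproduct of the middle algebra is conjugated
  by \<open>F\<close>; the inner ends of these conjugations cancel the outer factors of the middle co-associator,
  and their outer ends join \<open>G\<close> to form \<open>G F\<close>.
\<close>

lemma twisted_coassociator_twist: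
  fixes H :: "'h::complex_algebra_1 quasi_hopf"
  assumes "algebra_hom (comul H)" "invertible F" "invertible G"
  shows "twisted_coassociator (twist H F) G = twisted_coassociator H (G * F)"
proof -
  have leg: "tassoc (u \<otimes> 1) = leg12 u" "1 \<otimes> u = leg23 u" "tassoc (tmap D id u) = comul1 D u"
    for u :: "'h \<otimes> 'h" and D :: "'h \<Rightarrow> 'h \<otimes> 'h"
    by (simp_all add: leg12_def leg23_def comul1_def)
  have cancel: "h (minv F) * (h F * x) = x"
    if "algebra_hom h" for h :: "'h \<otimes> 'h \<Rightarrow> 'h \<otimes> 'h \<otimes> 'h" and x
    using algebra_hom_minv[OF that assms(2)] mult_minv_cancel by metis
  note hom = algebra_hom_mult[OF algebra_hom_leg12] algebra_hom_mult[OF algebra_hom_leg23]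
    algebra_hom_mult[OF algebra_hom_comul1] algebra_hom_mult[OF algebra_hom_tmap[OF algebra_hom_id]]
  show ?thesis
    unfolding twisted_coassociator_def leg
    using assms
    by (simp add: twist_def twisted_coassociator_def leg comul1_conjugate tmap_conjugate_right)
      (simp add: minv_mult hom cancel mult.assoc)
qed

locale twisted_hopf_algebra = hopf_algebra \<Delta> \<epsilon> S
  for \<Delta> :: "'h::complex_algebra_1 \<Rightarrow> 'h \<otimes> 'h" and \<epsilon> S +
  fixes F :: "'h \<otimes> 'h"
  assumes twist: "is_twist \<epsilon> F"
    and antipode_bij: "bij S"
begin

lemma invertible_twist [simp]: "invertible F"
  using twist by (simp add: is_twist_def)

lemma counit_twist: "eps_left \<epsilon> F = 1" "eps_right \<epsilon> F = 1"
  using twist by (simp_all add: is_twist_def)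

lemma counit_minv_twist: "eps_left \<epsilon> (minv F) = 1" "eps_right \<epsilon> (minv F) = 1"
proof -
  have 1: "minv (1 :: 'h) = 1"
    by (rule minv_unique) simp_all
  show "eps_left \<epsilon> (minv F) = 1" "eps_right \<epsilon> (minv F) = 1"
    using algebra_hom_minv(2)[of "eps_left \<epsilon>" F] algebra_hom_minv(2)[of "eps_right \<epsilon>" F]
    by (simp_all add: counit_twist 1)
qed

lemma cancel_twist:
  assumes "algebra_hom h"
  shows "h F * h (minv F) = 1" "h (minv F) * h F = 1"
    "h F * (h (minv F) * x) = x" "h (minv F) * (h F * x) = x"
  using algebra_hom_minv[OF assms invertible_twist] minv_inverse mult_minv_cancel by metis+

definition twisted_comul :: "'h \<Rightarrow> 'h \<otimes> 'h"
  where "twisted_comul a = F * \<Delta> a * minv F"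

definition coassoc :: "'h \<otimes> 'h \<otimes> 'h"
  where "coassoc = leg12 F * comul1 \<Delta> F * tmap id \<Delta> (minv F) * leg23 (minv F)"

definition coassoc_inv :: "'h \<otimes> 'h \<otimes> 'h"
  where "coassoc_inv = leg23 F * tmap id \<Delta> F * comul1 \<Delta> (minv F) * leg12 (minv F)"

lemma coassoc_inverse: "coassoc * coassoc_inv = 1" "coassoc_inv * coassoc = 1"
  by (simp_all add: coassoc_def coassoc_inv_def mult.assoc cancel_twist)

lemma minv_coassoc: "minv coassoc = coassoc_inv"
  by (rule minv_unique) (rule coassoc_inverse)+

lemma algebra_hom_twisted_comul: "algebra_hom twisted_comul"
proof (rule algebra_homI)
  show "clinear twisted_comul"
    unfolding twisted_comul_def by simp
qed (simp_all add: twisted_comul_def algebra_hom_mult[OF comul_hom] algebra_hom_one[OF comul_hom]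
    minv_inverse mult.assoc mult_minv_cancel)

lemma tmap_twisted_comul: "tmap id twisted_comul t = leg23 F * tmap id \<Delta> t * leg23 (minv F)"
  unfolding twisted_comul_def[abs_def] by (rule tmap_conjugate_right) simp

lemma comul1_twisted_comul: "comul1 twisted_comul t = leg12 F * comul1 \<Delta> t * leg12 (minv F)"
  unfolding twisted_comul_def[abs_def] by (rule comul1_conjugate) simp

lemma twisted_quasi_coassociative:
  "tmap id twisted_comul (twisted_comul a) =
    coassoc_inv * comul1 twisted_comul (twisted_comul a) * coassoc"
  by (simp add: tmap_twisted_comul comul1_twisted_comul, unfold twisted_comul_def)
    (simp add: algebra_hom_mult[of leg12] algebra_hom_mult[of leg23]
      algebra_hom_mult[of "comul1 \<Delta>"] algebra_hom_mult[of "tmap id \<Delta>"]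
      coassoc_def coassoc_inv_def mult.assoc cancel_twist comul1_comul)

text \<open>
  Let \<open>\<Delta>\<^sub>2\<close> be \<open>1 \<otimes> \<Delta> \<otimes> 1\<close>.  The simplifier expands both sides into products of images of \<open>F\<close> and its
  inverse and cancels; both become
  \<open>F\<^sub>1\<^sub>2 \<cdot> ((\<Delta> \<otimes> 1)F \<otimes> 1) \<cdot> \<Delta>\<^sub>2(\<Delta> \<otimes> 1)F \<cdot> \<Delta>\<^sub>2(1 \<otimes> \<Delta>)F\<^sup>-\<^sup>1 \<cdot> (1 \<otimes> (1 \<otimes> \<Delta>)F\<^sup>-\<^sup>1) \<cdot> F\<^sub>3\<^sub>4\<^sup>-\<^sup>1\<close>.
  On the left the middle part \<open>F\<^sub>3\<^sub>4\<^sup>-\<^sup>1 F\<^sub>1\<^sub>2\<^sup>-\<^sup>1 F\<^sub>3\<^sub>4 F\<^sub>1\<^sub>2\<close> disappears by commutation.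
\<close>

lemma twisted_pentagon:
  "comul1 twisted_comul coassoc * tmap id (tmap id twisted_comul) coassoc =
    leg123 coassoc * tmap id (comul1 twisted_comul) coassoc * leg23 coassoc"
proof -
  let ?F' = "minv F" and ?E2 = "tmap id (comul1 \<Delta>)"
  note homs = algebra_hom_mult[of leg12] algebra_hom_mult[of leg23] algebra_hom_mult[of leg123]
    algebra_hom_mult[of "comul1 \<Delta>"] algebra_hom_mult[of "tmap id \<Delta>"]
    algebra_hom_mult[of "tmap id (tmap id \<Delta>)"] algebra_hom_mult[of ?E2]
  \<comment> \<open>Oriented so that equal homomorphisms into the fourfold power reach one normal form.\<close>
  note rules = leg123_leg12 leg123_leg23 leg123_comul1[symmetric] leg123_tmap
    comul1_leg23 tmap_leg23 tmap_tmap_leg12 comul1_tmap comul1_comul1 tmap_tmap_comul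
  have E3: "tmap id (tmap id twisted_comul) t =
      leg23 (leg23 F) * tmap id (tmap id \<Delta>) t * leg23 (leg23 ?F')" for t :: "'h \<otimes> 'h \<otimes> 'h"
    unfolding tmap_twisted_comul[abs_def] by (rule tmap_conjugate_right) simp
  have E2: "tmap id (comul1 twisted_comul) t = leg23 (leg12 F) * ?E2 t * leg23 (leg12 ?F')"
    for t :: "'h \<otimes> 'h \<otimes> 'h"
    unfolding comul1_twisted_comul[abs_def] by (rule tmap_conjugate_right) simp
  have commute: "leg12 s * (leg23 (leg23 t) * x) = leg23 (leg23 t) * (leg12 s * x)"
    for s t :: "'h \<otimes> 'h" and x :: "'h \<otimes> 'h \<otimes> 'h \<otimes> 'h"
    by (simp add: leg12_leg23_commute flip: mult.assoc)
  have cancel: "g (h F) * (g (h ?F') * x) = x" "g (h ?F') * (g (h F) * x) = x"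
    if "algebra_hom g" "algebra_hom h" for x :: "'h \<otimes> 'h \<otimes> 'h \<otimes> 'h"
      and g :: "'h \<otimes> 'h \<otimes> 'h \<Rightarrow> 'h \<otimes> 'h \<otimes> 'h \<otimes> 'h" and h
    using cancel_twist(3,4)[OF algebra_hom_compose[OF that]] by simp_all
  note cancels = cancel_twist[of leg12] cancel[of leg23] cancel[of ?E2]
    cancel[of "tmap id (tmap id \<Delta>)" "comul1 \<Delta>"]
  show ?thesis
    by (simp add: E2 E3 comul1_twisted_comul coassoc_def homs rules mult.assoc cancels commute)
qed

text \<open>
  Applying \<open>1 \<otimes> \<epsilon> \<otimes> 1\<close> turns both inner factors into \<open>F\<close> and its inverse by the counit axioms, and both
  outer factors into \<open>1\<close> by the counit conditions on the twist.
\<close>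

lemma coassoc_counit: "tmap id (eps_left \<epsilon>) coassoc = 1"
proof -
  have "tmap id (eps_left \<epsilon>) (leg12 u) = eps_right \<epsilon> u \<otimes> (1 :: 'h)" for u :: "'h \<otimes> 'h"
    by (rule clinear_ext2[of "\<lambda>u. tmap id (eps_left \<epsilon>) (leg12 u)" "\<lambda>u. eps_right \<epsilon> u \<otimes> 1"])
      (simp_all add: clinear_compose[OF clinear_eps_right[OF clinear_counit]] leg12_tensor
        scaleC_tensor_left scaleC_tensor_right)
  moreover have assoc: "tmap id (eps_left \<epsilon>) (tassoc (s \<otimes> b)) = eps_right \<epsilon> s \<otimes> b" for s and b :: 'h
    by (rule clinear_ext2[of "\<lambda>s. tmap id (eps_left \<epsilon>) (tassoc (s \<otimes> b))" "\<lambda>s. eps_right \<epsilon> s \<otimes> b"])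
      (simp_all add: clinear_compose[OF clinear_eps_right[OF clinear_counit]] scaleC_tensor_left scaleC_tensor_right)
  moreover have "tmap id (eps_left \<epsilon>) (comul1 \<Delta> u) = u" for u :: "'h \<otimes> 'h"
    by (rule clinear_ext2[of "\<lambda>u. tmap id (eps_left \<epsilon>) (comul1 \<Delta> u)" "\<lambda>u. u"])
      (simp_all add: comul1_tensor counit_right assoc)
  moreover have "tmap id (eps_left \<epsilon>) (tmap id \<Delta> u) = u" for u :: "'h \<otimes> 'h"
    by (rule clinear_ext2[of "\<lambda>u. tmap id (eps_left \<epsilon>) (tmap id \<Delta> u)" "\<lambda>u. u"])
      (simp_all add: counit_left)
  ultimately show ?thesis
    by (simp add: coassoc_def algebra_hom_mult[of "tmap id (eps_left \<epsilon>)"] tmap_leg23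
        counit_twist counit_minv_twist mult.assoc minv_inverse leg23_def flip: one_tensor_def)
qed

definition twisted_alpha :: 'h
  where "twisted_alpha = left_action (minv F) 1"

definition twisted_beta :: 'h
  where "twisted_beta = right_action F 1"

lemma left_action_twist: "left_action F twisted_alpha = 1"
  by (simp add: twisted_alpha_def minv_inverse left_action_one flip: left_action_mult)

lemma right_action_minv_twist: "right_action (minv F) twisted_beta = 1"
  by (simp add: twisted_beta_def minv_inverse right_action_one flip: right_action_mult)

text \<open>
  The outer factors of the co-associator turn \<open>\<alpha>\<^sub>F\<close> and \<open>\<beta>\<^sub>F\<close> back into \<open>1\<close>; then the inner factors
  contribute only their counits.
\<close>

lemma zig_coassoc: "zig twisted_alpha twisted_beta coassoc = 1"
proof -
  have "zig twisted_alpha twisted_beta coassoc =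
      zig (left_action F twisted_alpha) (right_action (minv F) twisted_beta)
        (comul1 \<Delta> F * (1 * tmap id \<Delta> (minv F)))"
    by (simp only: coassoc_def mult.assoc zig_leg12 mult_1_left)
      (simp only: zig_leg23 flip: mult.assoc)
  also have "\<dots> = zig 1 1 1"
    unfolding left_action_twist right_action_minv_twist zig_comul1 zig_tmap_comul
    by (simp add: counit_twist counit_minv_twist antipode_one)
  also have "\<dots> = 1"
    by (simp add: one_tensor_def antipode_one)
  finally show ?thesis .
qed

lemma zag_coassoc_inv: "zag twisted_alpha twisted_beta coassoc_inv = 1"
proof -
  have "zag twisted_alpha twisted_beta coassoc_inv =
      zag (left_action F twisted_alpha) (right_action (minv F) twisted_beta)
        (tmap id \<Delta> F * (1 * comul1 \<Delta> (minv F)))"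
    by (simp only: coassoc_inv_def mult.assoc zag_leg23 mult_1_left)
      (simp only: zag_leg12 flip: mult.assoc)
  also have "\<dots> = zag 1 1 1"
    unfolding left_action_twist right_action_minv_twist zag_comul1 zag_tmap_comul
    by (simp add: counit_twist counit_minv_twist)
  also have "\<dots> = 1"
    by (simp add: one_tensor_def antipode_one)
  finally show ?thesis .
qed

lemma left_action_twisted_comul: "left_action (twisted_comul a) twisted_alpha = \<epsilon> a *\<^sub>C twisted_alpha"
  by (simp only: twisted_comul_def left_action_mult left_action_twist left_action_comul)
    (simp only: twisted_alpha_def clinear_scale[OF clinear_actions(3)])

lemma right_action_twisted_comul: "right_action (twisted_comul a) twisted_beta = \<epsilon> a *\<^sub>C twisted_beta"
  by (simp only: twisted_comul_def right_action_mult right_action_minv_twist right_action_comul)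
    (simp only: twisted_beta_def clinear_scale[OF clinear_actions(4)])

lemma twist_eq:
  "twist (quasi_hopf_of_hopf \<Delta> \<epsilon> S) F =
    \<lparr>comul = twisted_comul, counit = \<epsilon>, coassociator = coassoc, antipode = S,
     alpha = twisted_alpha, beta = twisted_beta\<rparr>"
proof -
  have "tmult (tmap S id u) = left_action u 1" "tmult (tmap id S u) = right_action u 1" for u
    by (simp_all add: tmult_tmap left_action_def right_action_def)
  then show ?thesis
    by (simp add: twist_def quasi_hopf_of_hopf_def twisted_coassociator_def twisted_comul_def[abs_def]
        twisted_alpha_def twisted_beta_def coassoc_def leg12_def leg23_def comul1_def
        flip: one_tensor_def)
qed

lemma quasi_hopf_algebra_twist: "quasi_hopf_algebra (twist (quasi_hopf_of_hopf \<Delta> \<epsilon> S) F)"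
  unfolding twist_eq
proof (unfold_locales, simp_all only: quasi_hopf.select_convs minv_coassoc)
  show "algebra_hom twisted_comul"
    by (rule algebra_hom_twisted_comul)
  show "algebra_hom \<epsilon>"
    by (rule counit_hom)
  show "invertible coassoc"
    using coassoc_inverse by (rule invertibleI)
  show "algebra_antihom S"
    by (rule antipode_antihom)
  show "bij S"
    by (rule antipode_bij)
  show "eps_left \<epsilon> (twisted_comul a) = a" "eps_right \<epsilon> (twisted_comul a) = a" for a
    by (simp_all add: twisted_comul_def algebra_hom_mult[of "eps_left \<epsilon>"]
        algebra_hom_mult[of "eps_right \<epsilon>"] counit_twist counit_minv_twist counit_left counit_right)
  show "tmap id twisted_comul (twisted_comul a) =
      coassoc_inv * tassoc (tmap twisted_comul id (twisted_comul a)) * coassoc" for a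
    using twisted_quasi_coassociative[of a] by (simp add: comul1_def)
  show "tassoc (tmap twisted_comul id coassoc) * tmap id (tmap id twisted_comul) coassoc =
      tmap id tassoc (tassoc (coassoc \<otimes> 1)) *
      tmap id (\<lambda>t. tassoc (tmap twisted_comul id t)) coassoc * 1 \<otimes> coassoc"
    using twisted_pentagon by (simp add: comul1_def leg123_def leg12_def leg23_def)
  show "tmap id (eps_left \<epsilon>) coassoc = 1"
    by (rule coassoc_counit)
  show "tlift (\<lambda>x. tlift (\<lambda>y z. S x * twisted_alpha * y * twisted_beta * S z)) coassoc = 1"
    using zig_coassoc by (simp add: zig_def)
  show "tlift (\<lambda>x. tlift (\<lambda>y z. x * twisted_beta * S y * twisted_alpha * z)) coassoc_inv = 1"
    using zag_coassoc_inv by (simp add: zag_def)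
  show "tlift (\<lambda>x y. S x * twisted_alpha * y) (twisted_comul a) = \<epsilon> a *\<^sub>C twisted_alpha" for a
    using left_action_twisted_comul by (simp add: left_action_def)
  show "tlift (\<lambda>x y. x * twisted_beta * S y) (twisted_comul a) = \<epsilon> a *\<^sub>C twisted_beta" for a
    using right_action_twisted_comul by (simp add: right_action_def)
qed

end

section \<open>Conjugations\<close>

lemma
  assumes "conjugation d"
  shows conjugation_add: "d (x + y) = d x + d y"
    and conjugation_scale: "d (c *\<^sub>C x) = cnj c *\<^sub>C d x"
    and conjugation_involution: "d (d x) = x"
    and conjugation_mult: "d (x * y) = d y * d x"
  using assms by (simp_all add: conjugation_def antilinear_def)

lemma conjugation_zero: "conjugation d \<Longrightarrow> d 0 = 0"
  by (rule additive_zero) (rule conjugation_add)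

lemma conjugation_one:
  assumes "conjugation d"
  shows "d 1 = 1"
  using conjugation_mult[OF assms, of "d 1" 1] by (simp add: conjugation_involution[OF assms])

lemma conjugation_minv:
  assumes "conjugation d" "invertible x"
  shows "invertible (d x)" "minv (d x) = d (minv x)"
proof -
  have "d x * d (minv x) = 1" "d (minv x) * d x = 1"
    using assms by (simp_all add: minv_inverse conjugation_one flip: conjugation_mult)
  then show "invertible (d x)" "minv (d x) = d (minv x)"
    by (rule invertibleI, rule minv_unique)
qed

lemma balanced_conjugation:
  assumes "conjugation d" "conjugation e"
  shows "balanced (\<lambda>a b. d a \<otimes> e b)"
  using assms
  by (simp add: balanced_def conjugation_zero conjugation_add conjugation_scale
      tensor_add_left tensor_add_right tensor_balanced)

lemma tmap_conjugation:
  "conjugation d \<Longrightarrow> conjugation e \<Longrightarrow> tmap d e (a \<otimes> b) = d a \<otimes> e b"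
  by (simp add: tmap_def balanced_conjugation)

lemma tmap_conjugation_add:
  "conjugation d \<Longrightarrow> conjugation e \<Longrightarrow> tmap d e (s + t) = tmap d e s + tmap d e t"
  by (simp add: tmap_def balanced_conjugation)

lemma conjugation_tmap:
  assumes d: "conjugation d" and e: "conjugation e"
  shows "conjugation (tmap d e)"
proof -
  note add = tmap_conjugation_add[OF d e] and tensor = tmap_conjugation[OF d e]
  have "tmap d e (c *\<^sub>C t) = cnj c *\<^sub>C tmap d e t" for c t
  proof (rule tensor_ext[of "\<lambda>t. tmap d e (c *\<^sub>C t)" "\<lambda>t. cnj c *\<^sub>C tmap d e t"])
    show "tmap d e (c *\<^sub>C (a \<otimes> b)) = cnj c *\<^sub>C tmap d e (a \<otimes> b)" for a b
      by (simp add: tensor conjugation_scale[OF d] flip: scaleC_tensor_left)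
  qed (simp_all add: add scaleC_add_right)
  moreover have "tmap d e (tmap d e t) = t" for t
    by (rule tensor_ext[of "\<lambda>t. tmap d e (tmap d e t)" "\<lambda>t. t"])
      (simp_all add: add tensor conjugation_involution d e)
  moreover have "tmap d e (s * t) = tmap d e t * tmap d e s" for s t
  proof (rule tensor_ext[of "\<lambda>s. tmap d e (s * t)" "\<lambda>s. tmap d e t * tmap d e s"])
    show "tmap d e ((a \<otimes> b) * t) = tmap d e t * tmap d e (a \<otimes> b)" for a b
      by (rule tensor_ext[of "\<lambda>t. tmap d e ((a \<otimes> b) * t)" "\<lambda>t. tmap d e t * tmap d e (a \<otimes> b)"])
        (simp_all add: add tensor distrib_left distrib_right mult_tensor conjugation_mult d e)
  qed (simp_all add: add distrib_left distrib_right)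
  ultimately show ?thesis
    by (simp add: conjugation_def antilinear_def add)
qed

lemma conj3_tassoc:
  assumes d: "conjugation d"
  shows "conj3 d (tassoc (s \<otimes> b)) = tassoc (conj2 d s \<otimes> d b)"
  by (rule tensor_ext[of "\<lambda>s. conj3 d (tassoc (s \<otimes> b))" "\<lambda>s. tassoc (conj2 d s \<otimes> d b)"])
    (simp_all add: tensor_add_left clinear_add[OF clinear_tassoc] tmap_conjugation_add
      tmap_conjugation conjugation_tmap d)

lemma conj3_leg12:
  assumes d: "conjugation d"
  shows "conj3 d (leg12 u) = leg12 (conj2 d u)"
  by (simp add: leg12_def conj3_tassoc d conjugation_one)

lemma conj3_leg23:
  assumes d: "conjugation d"
  shows "conj3 d (leg23 u) = leg23 (conj2 d u)"
  by (simp add: leg23_def tmap_conjugation conjugation_tmap d conjugation_one)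

section \<open>Hopf star algebras\<close>

context hopf_star_algebra
begin

text \<open>
  Conjugating the antipode axiom shows that \<open>T = \<dagger> S \<dagger>\<close> satisfies \<open>\<Sum> a\<^sub>2 T(a\<^sub>1) = \<epsilon>(a)\<close>.  Applying \<open>S\<close>,
  the map \<open>S T\<close> is a left convolution inverse of \<open>S\<close>, as the identity is a right one; so they agree.
\<close>

lemma antipode_dagger: "S (dagger (S (dagger a))) = a"
proof -
  have scale: "dagger (c *\<^sub>C x) = cnj c *\<^sub>C dagger x" for c x
    by (rule conjugation_scale[OF conjugation])
  have "a = S (dagger (S (dagger a))) * 1"
  proof (rule convolution_cancel[of "\<lambda>a. S (dagger (S (dagger a)))" S "\<lambda>a. a"])
    show "clinear (\<lambda>a. S (dagger (S (dagger a))))"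
      by (simp add: clinear_iff clinear_add[OF clinear_antipode] clinear_scale[OF clinear_antipode]
          conjugation_add[OF conjugation] scale)
    fix a
    have bil: "cbilinear (\<lambda>x y. S x * y)"
      by (simp add: cbilinear_def)
    have "tlift (\<lambda>x y. S (dagger x) * dagger y) (\<Delta> a) = tlift (\<lambda>x y. S x * y) (\<Delta> (dagger a))"
      unfolding comul_dagger tmap_def
      by (simp add: clinear_image_tlift[OF clinear_tlift[OF bil]] tlift_tensor_cbilinear[OF bil])
    also have "\<dots> = cnj (\<epsilon> a) *\<^sub>C 1"
      by (simp add: antipode_left_tlift counit_dagger)
    finally have "S (dagger (tlift (\<lambda>x y. S (dagger x) * dagger y) (\<Delta> a))) =
        S (dagger (cnj (\<epsilon> a) *\<^sub>C 1))"
      by simp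
    then show "tlift (\<lambda>x y. S (dagger (S (dagger x))) * S y) (\<Delta> a) = \<epsilon> a *\<^sub>C 1"
      by (simp add: tlift_image[of dagger] conjugation_zero[OF conjugation]
          conjugation_add[OF conjugation] conjugation_mult[OF conjugation]
          conjugation_involution[OF conjugation] conjugation_one[OF conjugation] scale
          clinear_image_tlift[OF clinear_antipode] clinear_scale[OF clinear_antipode]
          antipode_mult antipode_one)
  qed (simp_all add: antipode_left_tlift)
  then show ?thesis
    by simp
qed

lemma bij_antipode: "bij S"
proof (rule o_bij)
  show "S \<circ> (\<lambda>a. dagger (S (dagger a))) = id"
    by (simp add: fun_eq_iff antipode_dagger)
  have "dagger (S (dagger (S a))) = a" for a
    using antipode_dagger[of "dagger a"] conjugation_involution[OF conjugation] by metis
  then show "(\<lambda>a. dagger (S (dagger a))) \<circ> S = id"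
    by (simp add: fun_eq_iff)
qed

lemma conj3_comul1: "conj3 dagger (comul1 \<Delta> u) = comul1 \<Delta> (conj2 dagger u)"
  by (rule tensor_ext[of "\<lambda>u. conj3 dagger (comul1 \<Delta> u)" "\<lambda>u. comul1 \<Delta> (conj2 dagger u)"])
    (simp_all add: comul1_tensor conj3_tassoc comul_dagger clinear_add[OF clinear_comul1]
      tmap_conjugation_add tmap_conjugation conjugation_tmap conjugation)

lemma conj3_tmap_comul: "conj3 dagger (tmap id \<Delta> u) = tmap id \<Delta> (conj2 dagger u)"
  by (rule tensor_ext[of "\<lambda>u. conj3 dagger (tmap id \<Delta> u)" "\<lambda>u. tmap id \<Delta> (conj2 dagger u)"])
    (simp_all add: comul_dagger clinear_add[OF clinear_tmap]
      tmap_conjugation_add tmap_conjugation conjugation_tmap conjugation)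

lemma eps_conj2:
  "eps_left \<epsilon> (conj2 dagger u) = dagger (eps_left \<epsilon> u)"
  "eps_right \<epsilon> (conj2 dagger u) = dagger (eps_right \<epsilon> u)"
  by (rule tensor_ext[of "\<lambda>u. eps_left \<epsilon> (conj2 dagger u)" "\<lambda>u. dagger (eps_left \<epsilon> u)"]
      tensor_ext[of "\<lambda>u. eps_right \<epsilon> (conj2 dagger u)" "\<lambda>u. dagger (eps_right \<epsilon> u)"];
      simp add: clinear_add[OF clinear_eps_left] clinear_add[OF clinear_eps_right]
        tmap_conjugation_add tmap_conjugation conjugation_add conjugation_scale
        conjugation counit_dagger)+

end

lemma is_twist_mult:
  "algebra_hom \<epsilon> \<Longrightarrow> is_twist \<epsilon> F \<Longrightarrow> is_twist \<epsilon> G \<Longrightarrow> is_twist \<epsilon> (F * G)"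
  by (simp add: is_twist_def invertible_mult algebra_hom_mult[of "eps_left \<epsilon>"]
      algebra_hom_mult[of "eps_right \<epsilon>"])

theorem mainTheorem1:
  fixes \<Delta> :: "'h::complex_algebra_1 \<Rightarrow> 'h \<otimes> 'h"
    and \<epsilon> :: "'h \<Rightarrow> complex"
    and S dagger :: "'h \<Rightarrow> 'h"
    and F :: "'h \<otimes> 'h"
  assumes "hopf_star_algebra \<Delta> \<epsilon> S dagger"
    and "is_twist \<epsilon> F"
  shows
    "let H\<^sub>F = twist (quasi_hopf_of_hopf \<Delta> \<epsilon> S) F;
         \<Delta>\<^sub>F = comul H\<^sub>F;
         \<Phi>\<^sub>F = coassociator H\<^sub>F;
         \<Omega> = minv (F * conj2 dagger F)
     in is_twist \<epsilon> \<Omega> \<and> conj2 dagger \<Omega> = \<Omega> \<and>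
        quasi_hopf_star_algebra H\<^sub>F dagger \<Omega> \<and>
        (\<forall>a. conj2 dagger (\<Delta>\<^sub>F a) = \<Omega> * \<Delta>\<^sub>F (dagger a) * minv \<Omega>) \<and>
        minv (conj3 dagger \<Phi>\<^sub>F) =
          tassoc (\<Omega> \<otimes> (1 :: 'h)) * tassoc (tmap \<Delta>\<^sub>F id \<Omega>) * \<Phi>\<^sub>F *
          tmap id \<Delta>\<^sub>F (minv \<Omega>) * ((1 :: 'h) \<otimes> minv \<Omega>)"
proof -
  interpret hopf_star_algebra \<Delta> \<epsilon> S dagger
    by (rule assms(1))
  interpret F: twisted_hopf_algebra \<Delta> \<epsilon> S F
    by unfold_locales (use assms(2) bij_antipode in auto)
  \<comment> \<open>The conjugate of twisting by \<open>F\<close> is twisting by \<open>G\<close>, the inverse of the conjugate of \<open>F\<close>.\<close>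
  define G where "G = conj2 dagger (minv F)"
  define \<Omega> where "\<Omega> = minv (F * conj2 dagger F)"
  define H where "H = quasi_hopf_of_hopf \<Delta> \<epsilon> S"
  note conj2 = conjugation_tmap[OF conjugation conjugation]
  note conj3 = conjugation_tmap[OF conjugation conj2]
  have G: "G = minv (conj2 dagger F)" "minv G = conj2 dagger F"
    using conjugation_minv[OF conj2 F.invertible_twist]
      minv_minv[OF conjugation_minv(1)[OF conj2 F.invertible_twist]]
    by (simp_all add: G_def)
  have twist_inv: "is_twist \<epsilon> (minv F)"
    by (simp add: is_twist_def invertible_minv F.counit_minv_twist)
  have twist_G: "is_twist \<epsilon> G"
    unfolding is_twist_def G_def eps_conj2 F.counit_minv_twist
    using conjugation_minv(1)[OF conj2 invertible_minv[OF F.invertible_twist]]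
    by (simp add: conjugation_one[OF conjugation])
  interpret G: twisted_hopf_algebra \<Delta> \<epsilon> S G
    by unfold_locales (use twist_G bij_antipode in auto)
  have \<Omega>: "\<Omega> = G * minv F" "minv \<Omega> = F * minv G"
    using conjugation_minv(1)[OF conj2 F.invertible_twist]
    by (simp add: \<Omega>_def G minv_mult, simp add: \<Omega>_def G minv_minv invertible_mult)
  have twist_\<Omega>: "is_twist \<epsilon> \<Omega>"
    unfolding \<Omega>(1) by (rule is_twist_mult[OF counit_hom twist_G twist_inv])
  have \<Omega>F: "\<Omega> * F = G"
    by (simp add: \<Omega> mult.assoc minv_inverse)
  have selfadjoint: "conj2 dagger \<Omega> = \<Omega>"
    by (simp add: \<Omega>(1) conjugation_mult[OF conj2]) (simp add: G_def conjugation_involution[OF conj2])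
  have comul: "conj2 dagger (F.twisted_comul a) = \<Omega> * F.twisted_comul (dagger a) * minv \<Omega>" for a
    unfolding \<Omega>(2)
    by (simp add: F.twisted_comul_def conjugation_mult[OF conj2] \<Omega>(1) comul_dagger mult.assoc
        mult_minv_cancel) (simp add: G(2), simp add: G_def)
  have "conj3 dagger F.coassoc = G.coassoc_inv"
    unfolding F.coassoc_def G.coassoc_inv_def
    by (simp add: conjugation_mult[OF conj3] conj3_leg12[OF conjugation] conj3_leg23[OF conjugation]
        conj3_comul1 conj3_tmap_comul mult.assoc) (simp only: G(2) flip: G_def)
  then have "minv (conj3 dagger F.coassoc) = G.coassoc"
    using minv_unique[OF G.coassoc_inverse(2,1)] by simp
  also have "\<dots> = twisted_coassociator H G"
    using G.twist_eq by (simp add: twist_def H_def)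
  also have "\<dots> = twisted_coassociator (twist H F) \<Omega>"
    using twist_\<Omega> comul_hom
    by (subst twisted_coassociator_twist)
      (simp_all add: is_twist_def \<Omega>F H_def quasi_hopf_of_hopf_def)
  finally have coassociator:
    "minv (conj3 dagger F.coassoc) = twisted_coassociator (twist H F) \<Omega>" .
  have star: "quasi_hopf_star_algebra (twist H F) dagger \<Omega>"
    unfolding quasi_hopf_star_algebra_def quasi_hopf_star_algebra_axioms_def H_def
    using F.quasi_hopf_algebra_twist conjugation twist_\<Omega> comul coassociator counit_dagger
    by (simp add: F.twist_eq H_def)
  then interpret star: quasi_hopf_star_algebra "twist H F" dagger \<Omega> .
  show ?thesis
    unfolding Let_def \<Omega>_def[symmetric] H_def[symmetric]
    using twist_\<Omega> selfadjoint star star.comul_dagger star.coassociator_dagger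
    by (simp add: twisted_coassociator_def)
qed

end
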